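(* Assume $0<\alpha<1$ and $E\in \mathrm{Swath}(\alpha)$. Let $X_E(\alpha)$ and $(y_E(\alpha),S_E(\alpha))$ be the optimal solutions of $\mathrm{QP}_E(\alpha)$ and $\mathrm{QP}_E(\alpha)^*$, respectively. Define \[ E'=\frac{1}{1+t_E(\alpha)}\big(E+t_E(\alpha)\,X_E(\alpha)\big), \] where $t_E(\alpha)$ minimizes the convex quadratic polynomial $t\mapsto \mathrm{tr}\Big(\big((E+t\,X_E(\alpha))\,S_E(\alpha)\big)^2\Big)$. Then (i) $E'\in\mathrm{Swath}(\alpha)$; (ii) $\mathrm{tr}(CE)>\mathrm{tr}(CE')$; (iii) $b^Ty_E(\alpha)\le b^Ty_{E'}(\alpha)$. Moreover, if, beginning with $E_0\in\mathrm{Swath}(\alpha)$, this rule is applied recursively to produce a sequence $E_0,E_1,\ldots$ (with $E_{i+1}=E_i'$), then for every $i=0,1,\ldots$, \[ \frac{\mathrm{gap}_{E_{j+1}}}{\mathrm{gap}_{E_j}}\le 1-\frac{\kappa}{\kappa+\sqrt n}\quad\text{for } j=i \text{ or } j=i+1 \text{ (possibly both)},\qquad \kappa:=\alpha\sqrt{\tfrac{1-\alpha}{8}}. \]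
   Context: $\mathbb{S}^n$ is the space of real symmetric $n\times n$ matrices, $\mathbb{S}^n_{+}$ ($\mathbb{S}^n_{++}$) the positive semidefinite (definite) cone. Given $C,A_1,\ldots,A_m\in\mathbb{S}^n$ and $b\in\mathbb{R}^m$, let $\mathcal{A}(X)=(\mathrm{tr}(A_1X),\ldots,\mathrm{tr}(A_mX))$ and $\mathcal{A}^*y=\sum_i y_iA_i$. The semidefinite program is SDP: $\min\ \mathrm{tr}(CX)$ s.t. $\mathcal{A}(X)=b$, $X\succeq 0$, with dual $\max\ b^Ty$ s.t. $\mathcal{A}^*y+S=C$, $S\succeq0$. Standing assumptions: both SDP and its dual are strictly feasible (feasible points with $X$, resp. $S$, positive definite exist); $b\neq0$; $C$ is not a linear combination of $A_1,\ldots,A_m$; $A_1,\ldots,A_m$ are linearly independent. For $E\in\mathbb{S}^n_{++}$ define $\langle U,V\rangle_E=\mathrm{tr}(E^{-1}UE^{-1}V)$, $\|V\|_E=\langle V,V\rangle_E^{1/2}$, and for $\alpha>0$ the cone $K_E(\alpha)=\{X\in\mathbb{S}^n:\ \mathrm{tr}(E^{-1}X)\ge \alpha\|X\|_E\}$. $K_E(\alpha)^*$ denotes its dual cone with respect to the trace inner product, $\{S:\mathrm{tr}(XS)\ge0\ \forall X\in K_E(\alpha)\}$. $\mathrm{QP}_E(\alpha)$ is the problem $\min\ \mathrm{tr}(CX)$ s.t. $\mathcal{A}(X)=b$, $X\in K_E(\alpha)$; its dual $\mathrm{QP}_E(\alpha)^*$ is $\max\ b^Ty$ s.t. $\mathcal{A}^*y+S=C$,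 $S\in K_E(\alpha)^*$. $\mathrm{Swath}(\alpha)=\{E\in\mathbb{S}^n_{++}:\ \mathcal{A}(E)=b \text{ and } \mathrm{QP}_E(\alpha) \text{ has an optimal solution}\}$. For $E\in\mathrm{Swath}(\alpha)$, $\mathrm{gap}_E:=\mathrm{tr}(CE)-b^Ty_E(\alpha)$ where $(y_E(\alpha),S_E(\alpha))$ is the optimal solution of $\mathrm{QP}_E(\alpha)^*$. *)

theory Defs
  imports "HOL-Analysis.Analysis"
begin


definition symm :: "real^'n::finite^'n::finite \<Rightarrow> bool" where
  "symm M \<longleftrightarrow> transpose M = M"

definition posdef :: "real^'n::finite^'n::finite \<Rightarrow> bool" where
  "posdef M \<longleftrightarrow> symm M \<and> (\<forall>x. x \<noteq> 0 \<longrightarrow> x \<bullet> (M *v x) > 0)"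

definition Aop :: "('m::finite \<Rightarrow> real^'n::finite^'n::finite) \<Rightarrow> real^'n::finite^'n::finite \<Rightarrow> real^'m" where
  "Aop A X = (\<chi> i. trace (A i ** X))"

definition Aadj :: "('m::finite \<Rightarrow> real^'n::finite^'n::finite) \<Rightarrow> real^'m \<Rightarrow> real^'n::finite^'n::finite" where
  "Aadj A y = (\<Sum>i\<in>UNIV. (y $ i) *\<^sub>R A i)"

definition innerE :: "real^'n::finite^'n::finite \<Rightarrow> real^'n::finite^'n::finite \<Rightarrow> real^'n::finite^'n::finite \<Rightarrow> real" where
  "innerE E U V = trace (matrix_inv E ** U ** matrix_inv E ** V)"

definition normE :: "real^'n::finite^'n::finite \<Rightarrow> real^'n::finite^'n::finite \<Rightarrow> real" where
  "normE E V = sqrt (innerE E V V)"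

definition KE :: "real^'n::finite^'n::finite \<Rightarrow> real \<Rightarrow> (real^'n::finite^'n::finite) set" where
  "KE E \<alpha> = {X. symm X \<and> trace (matrix_inv E ** X) \<ge> \<alpha> * normE E X}"

definition KEdual :: "real^'n::finite^'n::finite \<Rightarrow> real \<Rightarrow> (real^'n::finite^'n::finite) set" where
  "KEdual E \<alpha> = {S. symm S \<and> (\<forall>X\<in>KE E \<alpha>. trace (X ** S) \<ge> 0)}"

definition QP_feas :: "('m::finite \<Rightarrow> real^'n::finite^'n::finite) \<Rightarrow> real^'m \<Rightarrow> real^'n::finite^'n::finite \<Rightarrow> real \<Rightarrow> real^'n::finite^'n::finite \<Rightarrow> bool" where
  "QP_feas A b E \<alpha> X \<longleftrightarrow> Aop A X = b \<and> X \<in> KE E \<alpha>"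

definition QP_opt :: "real^'n::finite^'n::finite \<Rightarrow> ('m::finite \<Rightarrow> real^'n::finite^'n::finite) \<Rightarrow> real^'m \<Rightarrow> real^'n::finite^'n::finite \<Rightarrow> real \<Rightarrow> real^'n::finite^'n::finite \<Rightarrow> bool" where
  "QP_opt C A b E \<alpha> X \<longleftrightarrow> QP_feas A b E \<alpha> X \<and>
     (\<forall>X'. QP_feas A b E \<alpha> X' \<longrightarrow> trace (C ** X) \<le> trace (C ** X'))"

definition QPdual_feas :: "real^'n::finite^'n::finite \<Rightarrow> ('m::finite \<Rightarrow> real^'n::finite^'n::finite) \<Rightarrow> real^'n::finite^'n::finite \<Rightarrow> real \<Rightarrow> real^'m \<Rightarrow> real^'n::finite^'n::finite \<Rightarrow> bool" where
  "QPdual_feas C A E \<alpha> y S \<longleftrightarrow> Aadj A y + S = C \<and> S \<in> KEdual E \<alpha>"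

definition QPdual_opt :: "real^'n::finite^'n::finite \<Rightarrow> ('m::finite \<Rightarrow> real^'n::finite^'n::finite) \<Rightarrow> real^'m \<Rightarrow> real^'n::finite^'n::finite \<Rightarrow> real \<Rightarrow> real^'m \<Rightarrow> real^'n::finite^'n::finite \<Rightarrow> bool" where
  "QPdual_opt C A b E \<alpha> y S \<longleftrightarrow> QPdual_feas C A E \<alpha> y S \<and>
     (\<forall>y' S'. QPdual_feas C A E \<alpha> y' S' \<longrightarrow> b \<bullet> y' \<le> b \<bullet> y)"

definition Swath :: "real^'n::finite^'n::finite \<Rightarrow> ('m::finite \<Rightarrow> real^'n::finite^'n::finite) \<Rightarrow> real^'m \<Rightarrow> real \<Rightarrow> (real^'n::finite^'n::finite) set" where
  "Swath C A b \<alpha> = {E. posdef E \<and> Aop A E = b \<and> (\<exists>X. QP_opt C A b E \<alpha> X)}"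

definition XE :: "real^'n::finite^'n::finite \<Rightarrow> ('m::finite \<Rightarrow> real^'n::finite^'n::finite) \<Rightarrow> real^'m \<Rightarrow> real^'n::finite^'n::finite \<Rightarrow> real \<Rightarrow> real^'n::finite^'n::finite" where
  "XE C A b E \<alpha> = (THE X. QP_opt C A b E \<alpha> X)"

definition ySE :: "real^'n::finite^'n::finite \<Rightarrow> ('m::finite \<Rightarrow> real^'n::finite^'n::finite) \<Rightarrow> real^'m \<Rightarrow> real^'n::finite^'n::finite \<Rightarrow> real \<Rightarrow> (real^'m) \<times> (real^'n::finite^'n::finite)" where
  "ySE C A b E \<alpha> = (THE yS. QPdual_opt C A b E \<alpha> (fst yS) (snd yS))"

definition yE where "yE C A b E \<alpha> = fst (ySE C A b E \<alpha>)"
definition SE where "SE C A b E \<alpha> = snd (ySE C A b E \<alpha>)"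

definition gapE :: "real^'n::finite^'n::finite \<Rightarrow> ('m::finite \<Rightarrow> real^'n::finite^'n::finite) \<Rightarrow> real^'m \<Rightarrow> real^'n::finite^'n::finite \<Rightarrow> real \<Rightarrow> real" where
  "gapE C A b E \<alpha> = trace (C ** E) - b \<bullet> yE C A b E \<alpha>"

definition tE :: "real^'n::finite^'n::finite \<Rightarrow> ('m::finite \<Rightarrow> real^'n::finite^'n::finite) \<Rightarrow> real^'m \<Rightarrow> real^'n::finite^'n::finite \<Rightarrow> real \<Rightarrow> real" where
  "tE C A b E \<alpha> = (THE t. \<forall>s.
     (let M = (E + t *\<^sub>R XE C A b E \<alpha>) ** SE C A b E \<alpha> in trace (M ** M)) \<le>
     (let M = (E + s *\<^sub>R XE C A b E \<alpha>) ** SE C A b E \<alpha> in trace (M ** M)))"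

definition nextE :: "real^'n::finite^'n::finite \<Rightarrow> ('m::finite \<Rightarrow> real^'n::finite^'n::finite) \<Rightarrow> real^'m \<Rightarrow> real \<Rightarrow> real^'n::finite^'n::finite \<Rightarrow> real^'n::finite^'n::finite" where
  "nextE C A b \<alpha> E = (1 / (1 + tE C A b E \<alpha>)) *\<^sub>R (E + tE C A b E \<alpha> *\<^sub>R XE C A b E \<alpha>)"

end

theory Submission
  imports Defs
begin

text \<open>
  Write \<open>E = R R\<^sup>T\<close>. In the coordinates \<open>X = R M R\<^sup>T\<close> the cone \<open>K\<^sub>E(\<alpha>)\<close> becomes the circular cone
  \<open>trace M \<ge> \<alpha> |M|\<close> (Frobenius norm), and first-order optimality forces \<open>X = k R Q R\<^sup>T\<close> and
  \<open>S = c R\<^sup>-\<^sup>T (I - Q) R\<^sup>-\<^sup>1\<close> with \<open>k, c > 0\<close> and \<open>trace Q = |Q|\<^sup>2 = \<alpha>\<^sup>2\<close>. Since \<open>trace (X S) = 0\<close>, minimising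
  \<open>trace (((E + t X) S)\<^sup>2)\<close> pushes \<open>S\<close> into the interior of the dual cone at \<open>E'\<close>; because \<open>|Q| = \<alpha> < 1\<close>,
  how far it goes is controlled by \<open>|trace (Q\<^sup>3)| \<le> \<alpha>\<^sup>3\<close> and \<open>trace (Q\<^sup>4) \<le> \<alpha>\<^sup>4\<close> alone. Interiority yields an
  optimal solution \<open>X'\<close> at \<open>E'\<close> and a dual gain \<open>trace (X' S)\<close> proportional to the norm of \<open>X'\<close>, whereas
  the next step length is at least \<open>\<alpha> / (2 |X'|)\<close>. So a large \<open>X'\<close> shrinks the gap in this step and a
  small one in the next; balancing the two gives \<open>\<kappa>\<close>.
\<close>

subsection \<open>Matrix algebra and the Frobenius norm\<close>

lemma trace_scaleR: "trace (k *\<^sub>R M) = k * trace (M :: real^'n^'n)"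
  by (simp add: trace_def sum_distrib_left)

lemma matrix_diff_ldistrib: "A ** (B - C) = A ** B - A ** (C :: real^'n^'n)"
  by (simp add: vec_eq_iff matrix_matrix_mult_def right_diff_distrib sum_subtractf)

lemma matrix_add_rdistrib: "(B + C) ** A = B ** A + C ** (A :: real^'n^'n)"
  by (simp add: vec_eq_iff matrix_matrix_mult_def distrib_right sum.distrib)

lemma matrix_diff_rdistrib: "(B - C) ** A = B ** A - C ** (A :: real^'n^'n)"
  by (simp add: vec_eq_iff matrix_matrix_mult_def left_diff_distrib sum_subtractf)

lemma transpose_add: "transpose (A + B) = transpose A + transpose (B :: real^'n^'n)"
  by (simp add: vec_eq_iff transpose_def)

lemma transpose_diff: "transpose (A - B) = transpose A - transpose (B :: real^'n^'n)"
  by (simp add: vec_eq_iff transpose_def)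

lemmas matrix_ring_simps = matrix_add_ldistrib matrix_add_rdistrib matrix_diff_ldistrib
  matrix_diff_rdistrib matrix_scalar_ac scalar_matrix_assoc[symmetric]
  trace_scaleR trace_add trace_sub

text \<open>The inner product of \<open>real^'n^'n\<close> is the entrywise one, hence the Frobenius
  product, so \<open>norm\<close> and Cauchy-Schwarz apply to traces.\<close>

lemma trace_transpose_mult: "trace (transpose U ** V) = U \<bullet> (V :: real^'n^'n)"
proof -
  have "trace (transpose U ** V) = (\<Sum>i\<in>UNIV. \<Sum>k\<in>UNIV. U $ k $ i * V $ k $ i)"
    by (simp add: trace_def matrix_matrix_mult_def transpose_def)
  also have "\<dots> = (\<Sum>k\<in>UNIV. \<Sum>i\<in>UNIV. U $ k $ i * V $ k $ i)"
    by (rule sum.swap)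
  finally show ?thesis
    by (simp add: inner_vec_def)
qed

lemma trace_mult_symm: "symm U \<Longrightarrow> trace (U ** V) = U \<bullet> (V :: real^'n^'n)"
  using trace_transpose_mult[of U V] by (simp add: symm_def)

lemma inner_mat_1: "mat 1 \<bullet> M = trace (M :: real^'n^'n)"
  using trace_transpose_mult[of "mat 1" M] by simp

lemma norm_mat_1_sq: "(mat 1 :: real^'n^'n) \<bullet> mat 1 = CARD('n)"
  by (simp add: inner_mat_1 trace_I)

lemma inner_add_scaleR_self:
  "(P + e *\<^sub>R N) \<bullet> (P + e *\<^sub>R N) = P \<bullet> P + 2 * e * (P \<bullet> N) + e\<^sup>2 * (N \<bullet> N)"
proof -
  have "N \<bullet> P = P \<bullet> N" by (rule inner_commute)
  then show ?thesis
    by (simp add: inner_add_left inner_add_right power2_eq_square distrib_left)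
qed

lemma symm_mat_1 [simp]: "symm (mat 1)"
  by (simp add: symm_def)

lemma symm_add: "symm U \<Longrightarrow> symm V \<Longrightarrow> symm (U + V)"
  by (simp add: symm_def transpose_add)

lemma symm_diff: "symm U \<Longrightarrow> symm V \<Longrightarrow> symm (U - V)"
  by (simp add: symm_def transpose_diff)

lemma symm_scaleR: "symm U \<Longrightarrow> symm (k *\<^sub>R U)"
  by (simp add: symm_def transpose_scalar)

lemma symm_0 [simp]: "symm 0"
  by (simp add: symm_def vec_eq_iff transpose_def)

lemma symm_congruence: "symm M \<Longrightarrow> symm (R ** M ** transpose R)"
  by (simp add: symm_def matrix_transpose_mul matrix_mul_assoc)

lemma symm_square: "symm Q \<Longrightarrow> symm (Q ** Q)"
  by (simp add: symm_def matrix_transpose_mul)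

text \<open>Each entry of the product is a row of \<open>M\<close> times a column of
  \<open>N\<close>; Cauchy-Schwarz is applied entry by entry and summed.\<close>

lemma norm_matrix_mult_le:
  fixes M N :: "real^'n^'n"
  shows "norm (M ** N) \<le> norm M * norm N"
proof -
  have sq: "norm K ^ 2 = (\<Sum>i\<in>UNIV. norm (K $ i) ^ 2)" for K :: "real^'n^'n"
    by (simp add: power2_norm_eq_inner inner_vec_def)
  have ent: "(M ** N) $ i $ j = M $ i \<bullet> (transpose N $ j)" for i j
    by (simp add: matrix_matrix_mult_def inner_vec_def transpose_def)
  have tr: "norm (transpose N) = norm N"
    by (simp add: norm_eq_sqrt_inner flip: trace_transpose_mult)
       (metis trace_mul_sym)
  have "norm (M ** N) ^ 2 = (\<Sum>i\<in>UNIV. \<Sum>j\<in>UNIV. (M $ i \<bullet> (transpose N $ j))^2)"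
    unfolding power2_norm_eq_inner inner_vec_def[of "M ** N"] inner_vec_def[of "(M ** N) $ _"] ent
    by (simp add: power2_eq_square)
  also have "\<dots> \<le> (\<Sum>i\<in>UNIV. \<Sum>j\<in>UNIV. norm (M $ i) ^ 2 * norm (transpose N $ j) ^ 2)"
    by (intro sum_mono) (simp add: Cauchy_Schwarz_ineq power2_norm_eq_inner)
  also have "\<dots> = norm M ^ 2 * norm (transpose N) ^ 2"
    unfolding sq[of M] sq[of "transpose N"] by (simp add: sum_product)
  finally have "norm (M ** N) ^ 2 \<le> (norm M * norm N) ^ 2"
    by (simp add: tr power_mult_distrib)
  then show ?thesis
    by (rule power2_le_imp_le) simp
qed

subsection \<open>Factorisation of positive definite matrices\<close>

lemma symm_inner_mult: "symm M \<Longrightarrow> x \<bullet> (M *v y) = (M *v x) \<bullet> y"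
  by (metis dot_lmul_matrix symm_def transpose_matrix_vector)

text \<open>Gram-Schmidt for the inner product \<open>x \<bullet> (E *v y)\<close>: the rows of
  \<open>T\<close> form an orthonormal basis for it, so
  \<open>T ** E ** transpose T = mat 1\<close>, and \<open>R\<close> is the inverse of
  \<open>T\<close>.\<close>

lemma posdef_factor:
  fixes E :: "real^'n^'n"
  assumes "posdef E"
  obtains R T :: "real^'n^'n" where "R ** T = mat 1" "T ** R = mat 1" "E = R ** transpose R"
proof -
  have sym: "symm E" and pos: "\<And>x. x \<noteq> 0 \<Longrightarrow> x \<bullet> (E *v x) > 0"
    using assms by (auto simp: posdef_def)
  have "\<exists>f :: 'n \<Rightarrow> real^'n. \<forall>i\<in>J. \<forall>j\<in>J. f i \<bullet> (E *v f j) = (if i = j then 1 else 0)"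
    if "finite J" for J :: "'n set"
    using that
  proof (induction J)
    case (insert k J)
    then obtain f :: "'n \<Rightarrow> real^'n"
      where f: "\<And>i j. i \<in> J \<Longrightarrow> j \<in> J \<Longrightarrow> f i \<bullet> (E *v f j) = (if i = j then 1 else 0)"
      by blast
    let ?B = "(\<lambda>j. E *v f j) ` J"
    \<comment> \<open>Fewer than n vectors \<open>E *v f j\<close> leave a nonzero \<open>x\<close>
      orthogonal to all of them; scaled to \<open>z\<close>, it extends the family.\<close>
    have "dim ?B \<le> card ?B"
      by (rule dim_le_card) (use insert in \<open>auto intro: span_base\<close>)
    also have "\<dots> \<le> card J"
      using insert by (simp add: card_image_le)
    also have "\<dots> < DIM(real^'n)"
      using insert psubset_card_mono[of UNIV J] by auto
    finally obtain x where x: "x \<noteq> 0" "\<And>y. y \<in> span ?B \<Longrightarrow> orthogonal x y"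
      using orthogonal_to_subspace_exists by blast
    define s where "s = sqrt (x \<bullet> (E *v x))"
    have s: "s > 0" "s * s = x \<bullet> (E *v x)"
      using pos[OF x(1)] by (auto simp: s_def)
    define z where "z = (1 / s) *\<^sub>R x"
    have zz: "z \<bullet> (E *v z) = 1"
      using s pos[OF x(1)] by (simp add: z_def matrix_vector_mult_scaleR)
    have zf: "z \<bullet> (E *v f j) = 0" if "j \<in> J" for j
      using x(2)[of "E *v f j"] that by (auto simp: z_def orthogonal_def intro: span_base)
    have fz: "f j \<bullet> (E *v z) = 0" if "j \<in> J" for j
      using zf[OF that] symm_inner_mult[OF sym] by (metis inner_commute)
    show ?case
      by (rule exI[of _ "f(k := z)"]) (use insert f zz zf fz in auto)
  qed auto
  from this[of UNIV] obtain f :: "'n \<Rightarrow> real^'n"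
    where f: "\<And>i j. f i \<bullet> (E *v f j) = (if i = j then 1 else 0)"
    by auto
  define T where "T = (\<chi> i. f i)"
  have "(T ** E ** transpose T) $ i $ j = mat 1 $ i $ j" for i j
  proof -
    have "(T ** E ** transpose T) $ i $ j = (T ** (E ** transpose T)) $ i $ j"
      by (simp add: matrix_mul_assoc)
    also have "\<dots> = f i \<bullet> (E *v f j)"
      by (simp add: matrix_matrix_mult_def matrix_vector_mult_def inner_vec_def T_def transpose_def)
    finally show ?thesis
      by (simp add: f mat_def)
  qed
  then have TET: "T ** E ** transpose T = mat 1"
    by (simp add: vec_eq_iff)
  then obtain R where R: "T ** R = mat 1"
    by (metis matrix_mul_assoc)
  then have R': "R ** T = mat 1"
    by (simp add: matrix_left_right_inverse)
  have tr: "transpose T ** transpose R = mat 1"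
    using R' by (metis matrix_transpose_mul transpose_mat)
  have "R ** transpose R = R ** (T ** E ** transpose T) ** transpose R"
    by (simp add: TET)
  also have "\<dots> = (R ** T) ** E ** (transpose T ** transpose R)"
    by (simp add: matrix_mul_assoc)
  also have "\<dots> = E"
    by (simp add: R' tr)
  finally show ?thesis
    using that[OF R' R] by simp
qed

lemma matrix_inv_factor:
  fixes R T :: "real^'n^'n"
  assumes "R ** T = mat 1" "T ** R = mat 1"
  shows "matrix_inv (R ** transpose R) = transpose T ** T"
proof -
  have tr: "transpose T ** transpose R = mat 1" "transpose R ** transpose T = mat 1"
    using assms by (metis matrix_transpose_mul transpose_mat)+
  have 1: "(R ** transpose R) ** (transpose T ** T) = mat 1"
    using assms tr by (metis matrix_mul_assoc matrix_mul_rid)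
  have 2: "(transpose T ** T) ** (R ** transpose R) = mat 1"
    using assms tr by (metis matrix_mul_assoc matrix_mul_rid)
  show ?thesis
    unfolding matrix_inv_def
  \<comment> \<open>\<open>matrix_inv\<close> is a Hilbert choice, so the inverse must also be shown
    to be the only one.\<close>
  proof (rule some_equality)
    fix N assume N: "(R ** transpose R) ** N = mat 1 \<and> N ** (R ** transpose R) = mat 1"
    have "N = (transpose T ** T) ** (R ** transpose R) ** N"
      by (simp add: 2)
    also have "\<dots> = transpose T ** T"
      using N by (simp flip: matrix_mul_assoc)
    finally show "N = transpose T ** T" .
  qed (use 1 2 in blast)
qed

lemma posdef_congruence:
  fixes R T M :: "real^'n^'n"
  assumes "R ** T = mat 1" "posdef M"
  shows "posdef (R ** M ** transpose R)"
  unfolding posdef_def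
proof (intro conjI allI impI)
  show "symm (R ** M ** transpose R)"
    using assms by (simp add: posdef_def symm_congruence)
  fix x :: "real^'n" assume "x \<noteq> 0"
  define y where "y = transpose R *v x"
  have "transpose T *v y = x"
    unfolding y_def matrix_vector_mul_assoc using assms(1)
    by (metis matrix_transpose_mul transpose_mat matrix_vector_mul_lid)
  with \<open>x \<noteq> 0\<close> have "y \<noteq> 0" by auto
  have "x \<bullet> ((R ** M ** transpose R) *v x) = x \<bullet> (R *v (M *v y))"
    by (simp add: y_def matrix_vector_mul_assoc matrix_mul_assoc del: transpose_matrix_vector)
  also have "\<dots> = y \<bullet> (M *v y)"
    by (simp add: y_def dot_lmul_matrix)
  finally show "0 < x \<bullet> ((R ** M ** transpose R) *v x)"
    using assms(2) \<open>y \<noteq> 0\<close> by (simp add: posdef_def)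
qed

lemma posdef_scaleR: "k > 0 \<Longrightarrow> posdef M \<Longrightarrow> posdef (k *\<^sub>R M)"
  by (auto simp: posdef_def symm_scaleR simp flip: scaleR_matrix_vector_assoc)

subsection \<open>The cone in normalised coordinates\<close>

lemma trace_congruence:
  "trace (R ** M ** transpose R ** S) = trace (M ** (transpose R ** S ** (R :: real^'n^'n)))"
  by (metis matrix_mul_assoc trace_mul_sym)

context
  fixes R T :: "real^'n^'n"
  assumes RT: "R ** T = mat 1" and TR: "T ** R = mat 1"
begin

lemma transpose_inverse_factor:
  "transpose T ** transpose R = mat 1" "transpose R ** transpose T = mat 1"
  using RT TR by (metis matrix_transpose_mul transpose_mat)+

text \<open>The first two equations undo the coordinates of primal matrices, the last two those of
  dual matrices.\<close>

lemma congruence_inverse: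
  "T ** (R ** M ** transpose R) ** transpose T = M"
  "R ** (T ** M ** transpose T) ** transpose R = M"
  "transpose R ** (transpose T ** M ** T) ** R = M"
  "transpose T ** (transpose R ** M ** R) ** T = M"
  using RT TR transpose_inverse_factor
  by (metis matrix_mul_assoc matrix_mul_rid matrix_mul_lid)+

lemma trace_inv_factor:
  "trace (matrix_inv (R ** transpose R) ** (R ** M ** transpose R)) = trace M"
proof -
  have "trace (matrix_inv (R ** transpose R) ** (R ** M ** transpose R))
      = trace (transpose T ** (T ** (R ** M ** transpose R)))"
    by (simp add: matrix_inv_factor[OF RT TR] matrix_mul_assoc)
  also have "\<dots> = trace (T ** (R ** M ** transpose R) ** transpose T)"
    by (rule trace_mul_sym)
  finally show ?thesis
    by (simp add: congruence_inverse)
qed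

lemma innerE_factor:
  "innerE (R ** transpose R) (R ** U ** transpose R) (R ** V ** transpose R) = trace (U ** V)"
proof -
  have "innerE (R ** transpose R) (R ** U ** transpose R) (R ** V ** transpose R)
      = trace (transpose T ** ((T ** (R ** U ** transpose R) ** transpose T) ** (T ** (R ** V ** transpose R))))"
    by (simp add: innerE_def matrix_inv_factor[OF RT TR] matrix_mul_assoc)
  also have "\<dots> = trace (((T ** (R ** U ** transpose R) ** transpose T) ** (T ** (R ** V ** transpose R))) ** transpose T)"
    by (rule trace_mul_sym)
  also have "\<dots> = trace ((T ** (R ** U ** transpose R) ** transpose T) ** (T ** (R ** V ** transpose R) ** transpose T))"
    by (simp add: matrix_mul_assoc)
  finally show ?thesis
    by (simp add: congruence_inverse)
qed

lemma normE_factor: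
  "symm M \<Longrightarrow> normE (R ** transpose R) (R ** M ** transpose R) = norm M"
  by (simp add: normE_def innerE_factor trace_mult_symm norm_eq_sqrt_inner)

lemma symm_congruence_iff: "symm (R ** M ** transpose R) \<longleftrightarrow> symm M"
  using symm_congruence[of "R ** M ** transpose R" T] symm_congruence[of M R]
  by (auto simp: congruence_inverse)

text \<open>Congruence by \<open>R\<close> takes \<open>mat 1\<close> to \<open>E\<close> and the
  Frobenius norm to the local norm, so each cone \<open>KE E \<alpha>\<close> is an image of the
  same circular cone around \<open>mat 1\<close>.\<close>

lemma KE_factor:
  "R ** M ** transpose R \<in> KE (R ** transpose R) \<alpha> \<longleftrightarrow> symm M \<and> \<alpha> * norm M \<le> trace M"
  by (auto simp: KE_def symm_congruence_iff normE_factor trace_inv_factor)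

end

subsection \<open>Geometry of the circular cone\<close>

text \<open>A Farkas-type argument: perturbing by \<open>D0\<close> extends \<open>f \<ge> 0\<close>
  to the kernel of \<open>l\<close>, which is closed under negation, so \<open>f\<close> vanishes
  there; each \<open>D\<close> minus a multiple of \<open>D0\<close> lies in that kernel.\<close>

lemma functional_proportional:
  fixes f l :: "'a::real_vector \<Rightarrow> real"
  assumes W: "subspace W" and f: "linear f" and l: "linear l"
    and D0: "D0 \<in> W" "l D0 > 0"
    and pos: "\<And>D. D \<in> W \<Longrightarrow> l D > 0 \<Longrightarrow> f D \<ge> 0"
  obtains r where "r \<ge> 0" "\<And>D. D \<in> W \<Longrightarrow> f D = r * l D"
proof
  define r where "r = f D0 / l D0"
  show "r \<ge> 0"
    using pos[OF D0] D0 by (simp add: r_def)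
  have zero: "f D \<ge> 0" if "D \<in> W" "l D = 0" for D
  proof (rule ccontr)
    assume neg: "\<not> f D \<ge> 0"
    \<comment> \<open>This makes the value at \<open>D + e *\<^sub>R D0\<close> equal to
      \<open>f D / 2 - e < 0\<close>; the added 1 keeps the denominator positive when
      \<open>f D0 = 0\<close>.\<close>
    define e where "e = (- f D / 2) / (f D0 + 1)"
    have f0: "f D0 \<ge> 0" using pos D0 by blast
    have "e > 0" unfolding e_def using neg f0 by (intro divide_pos_pos) auto
    have "D + e *\<^sub>R D0 \<in> W"
      using W that D0 by (simp add: subspace_add subspace_scale)
    moreover have "l (D + e *\<^sub>R D0) > 0"
      using that D0 \<open>e > 0\<close> by (simp add: linear_add[OF l] linear_cmul[OF l])
    ultimately have "0 \<le> f D + e * f D0"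
      using pos[of "D + e *\<^sub>R D0"] by (simp add: linear_add[OF f] linear_cmul[OF f])
    moreover have "e * (f D0 + 1) = - f D / 2"
      using f0 nonzero_eq_divide_eq[of "f D0 + 1" e "- f D / 2"] by (simp add: e_def)
    then have "e * f D0 = - f D / 2 - e"
      by (simp only: distrib_left mult_1_right)
    ultimately show False using neg \<open>e > 0\<close> by linarith
  qed
  fix D assume D: "D \<in> W"
  define Z where "Z = D - (l D / l D0) *\<^sub>R D0"
  have Z: "Z \<in> W"
    using W D D0 by (simp add: Z_def subspace_diff subspace_scale)
  have "l Z = 0"
    using D0 by (simp add: Z_def linear_diff[OF l] linear_cmul[OF l])
  then have "f Z \<ge> 0" "f (- Z) \<ge> 0"
    using zero[OF Z] zero[of "- Z"] Z W by (auto simp: subspace_neg linear_neg[OF l])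
  then have "f Z = 0"
    by (simp add: linear_neg[OF f])
  then show "f D = r * l D"
    by (simp add: Z_def r_def linear_diff[OF f] linear_cmul[OF f])
qed

text \<open>Squaring the cone condition gives a quadratic in \<open>e\<close> whose constant term is
  positive, or nonnegative with a positive linear term. It is positive for small \<open>e\<close>,
  where the trace is still positive, so the squares can be removed.\<close>

lemma cone_feasible_direction:
  fixes X D :: "real^'n^'n"
  assumes pos: "0 < trace X" and a: "0 < \<alpha>" and X: "\<alpha> * norm X \<le> trace X"
    and D: "\<alpha> * norm X < trace X \<or> trace X * trace D - \<alpha>\<^sup>2 * (X \<bullet> D) > 0"
  obtains e where "e > 0" "\<alpha> * norm (X + e *\<^sub>R D) \<le> trace (X + e *\<^sub>R D)"
proof -
  define g where "g = (\<lambda>e. (trace X + e * trace D)\<^sup>2 - \<alpha>\<^sup>2 * ((X + e *\<^sub>R D) \<bullet> (X + e *\<^sub>R D)))"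
  define g0 where "g0 = (trace X)\<^sup>2 - \<alpha>\<^sup>2 * (X \<bullet> X)"
  define g1 where "g1 = trace X * trace D - \<alpha>\<^sup>2 * (X \<bullet> D)"
  define g2 where "g2 = (trace D)\<^sup>2 - \<alpha>\<^sup>2 * (D \<bullet> D)"
  have g: "g e = g0 + 2 * e * g1 + e\<^sup>2 * g2" for e
  proof -
    have "(t + e * d)\<^sup>2 - a * (x + 2 * e * y + e\<^sup>2 * z)
        = (t\<^sup>2 - a * x) + 2 * e * (t * d - a * y) + e\<^sup>2 * (d\<^sup>2 - a * z)" for t d a x y z :: real
      by (simp add: power2_eq_square algebra_simps)
    then show ?thesis
      by (simp only: g_def g0_def g1_def g2_def inner_add_scaleR_self)
  qed
  have g0: "g0 = (trace X)\<^sup>2 - (\<alpha> * norm X)\<^sup>2"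
    by (simp add: g0_def power_mult_distrib power2_norm_eq_inner)
  have "g0 > 0 \<or> g0 \<ge> 0 \<and> g1 > 0"
    using D
  proof
    assume "\<alpha> * norm X < trace X"
    then have "(\<alpha> * norm X)\<^sup>2 < (trace X)\<^sup>2"
      using a by (intro power_strict_mono) auto
    then show ?thesis by (simp add: g0)
  next
    assume "trace X * trace D - \<alpha>\<^sup>2 * (X \<bullet> D) > 0"
    moreover have "(\<alpha> * norm X)\<^sup>2 \<le> (trace X)\<^sup>2"
      using X a by (intro power_mono) auto
    ultimately show ?thesis by (simp add: g0 g1_def)
  qed
  then have "eventually (\<lambda>e. g e > 0) (at_right 0)"
  proof
    assume "g0 > 0"
    have "((\<lambda>e. g0 + 2 * e * g1 + e\<^sup>2 * g2) \<longlongrightarrow> g0 + 2 * 0 * g1 + 0\<^sup>2 * g2) (at_right 0)"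
      by (intro tendsto_intros)
    from order_tendstoD(1)[OF this, of 0] show ?thesis
      using \<open>g0 > 0\<close> by (simp add: g)
  next
    assume h: "g0 \<ge> 0 \<and> g1 > 0"
    have "((\<lambda>e. 2 * g1 + e * g2) \<longlongrightarrow> 2 * g1 + 0 * g2) (at_right 0)"
      by (intro tendsto_intros)
    from order_tendstoD(1)[OF this, of 0]
    have "eventually (\<lambda>e. 2 * g1 + e * g2 > 0) (at_right 0)"
      using h by simp
    moreover have "eventually (\<lambda>e::real. e > 0) (at_right 0)"
      by (simp add: eventually_at_right_less)
    ultimately show ?thesis
    proof eventually_elim
      case (elim e)
      then have "e * (2 * g1 + e * g2) > 0" by simp
      then show ?case using h by (simp add: g algebra_simps power2_eq_square)
    qed
  qed
  moreover have "eventually (\<lambda>e. trace X + e * trace D > 0) (at_right 0)"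
  proof -
    have "((\<lambda>e. trace X + e * trace D) \<longlongrightarrow> trace X + 0 * trace D) (at_right 0)"
      by (intro tendsto_intros)
    from order_tendstoD(1)[OF this, of 0] show ?thesis
      using pos by simp
  qed
  moreover have "eventually (\<lambda>e::real. e > 0) (at_right 0)"
    by (simp add: eventually_at_right_less)
  ultimately have "eventually (\<lambda>e. e > 0 \<and> \<alpha> * norm (X + e *\<^sub>R D) \<le> trace (X + e *\<^sub>R D)) (at_right 0)"
  proof eventually_elim
    case (elim e)
    have "(\<alpha> * norm (X + e *\<^sub>R D))\<^sup>2 \<le> (trace X + e * trace D)\<^sup>2"
      using elim(1) by (simp add: g_def power_mult_distrib power2_norm_eq_inner)
    then have "\<alpha> * norm (X + e *\<^sub>R D) \<le> trace X + e * trace D"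
      by (rule power2_le_imp_le) (use elim(2) in auto)
    then show ?case using elim by (simp add: trace_add trace_scaleR)
  qed
  then have "\<exists>e. e > 0 \<and> \<alpha> * norm (X + e *\<^sub>R D) \<le> trace (X + e *\<^sub>R D)"
    using eventually_happens'[of "at_right (0::real)"] by simp
  then show ?thesis using that by blast
qed

text \<open>Both matrices are split into a multiple of the identity and a trace-free part, and
  Cauchy-Schwarz bounds the trace-free product. Equality in \<open>nS\<close> with
  \<open>d = 0\<close> describes the boundary of the dual cone; the norm deficit \<open>d\<close>
  buys the margin \<open>h\<close>.\<close>

lemma dual_cone_interior:
  fixes M S :: "real^'n^'n"
  assumes a: "0 < \<alpha>" "\<alpha> < 1" and M: "\<alpha> * norm M \<le> trace M"
    and c: "c > 0" and trS: "trace S = c * (real CARD('n) - \<alpha>\<^sup>2)"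
    and nS: "S \<bullet> S \<le> c\<^sup>2 * (real CARD('n) - \<alpha>\<^sup>2 - d)"
    and h: "0 \<le> h" "h \<le> \<alpha>" "2 * \<alpha> * h \<le> d"
  shows "norm M * (trace S * h / CARD('n)) \<le> M \<bullet> S"
proof -
  define n where "n = real CARD('n)"
  have n1: "n \<ge> 1" by (simp add: n_def Suc_leI)
  have a2: "\<alpha>\<^sup>2 < 1" "\<alpha>\<^sup>2 > 0" using a by (auto simp: power_less_one_iff abs_square_less_1)
  define m s where "m = trace M" and "s = trace S"
  define M' S' where "M' = M - (m / n) *\<^sub>R mat 1" and "S' = S - (s / n) *\<^sub>R mat 1"
  have m0: "0 \<le> \<alpha> * norm M" "\<alpha> * norm M \<le> m" using a M by (auto simp: m_def)
  have II: "(mat 1 :: real^'n^'n) \<bullet> mat 1 = n" by (simp add: norm_mat_1_sq n_def)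
  have IM: "mat 1 \<bullet> M = m" "M \<bullet> mat 1 = m" "mat 1 \<bullet> S = s" "S \<bullet> mat 1 = s"
    by (auto simp: inner_mat_1 m_def s_def inner_commute[of _ "mat 1"])
  have n0: "n \<noteq> 0" using n1 by simp
  have MM: "M' \<bullet> M' = M \<bullet> M - m\<^sup>2 / n"
    using n0 by (simp add: M'_def inner_diff_left inner_diff_right II IM power2_eq_square field_simps)
  have SS: "S' \<bullet> S' = S \<bullet> S - s\<^sup>2 / n"
    using n0 by (simp add: S'_def inner_diff_left inner_diff_right II IM power2_eq_square field_simps)
  have MS: "M \<bullet> S = m * s / n + M' \<bullet> S'"
    using n0 by (simp add: M'_def S'_def inner_diff_left inner_diff_right II IM field_simps)
  have s: "s = c * (n - \<alpha>\<^sup>2)" by (simp add: s_def n_def trS)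
  have s0: "s > 0" using c n1 a2 by (simp add: s)
  have "(norm M')\<^sup>2 \<le> (norm M)\<^sup>2 * ((n - \<alpha>\<^sup>2) / n)"
  proof -
    have "(\<alpha> * norm M)\<^sup>2 \<le> m\<^sup>2" using m0 by (intro power_mono) auto
    then have "\<alpha>\<^sup>2 * (norm M)\<^sup>2 / n \<le> m\<^sup>2 / n" using n1 by (simp add: divide_right_mono power_mult_distrib)
    moreover have "(norm M)\<^sup>2 * ((n - \<alpha>\<^sup>2) / n) = (norm M)\<^sup>2 - \<alpha>\<^sup>2 * (norm M)\<^sup>2 / n"
      using n0 by (simp add: field_simps)
    ultimately show ?thesis using MM by (simp only: power2_norm_eq_inner)
  qed
  moreover have "(norm S')\<^sup>2 * ((n - \<alpha>\<^sup>2) / n) \<le> (s * (\<alpha> - h) / n)\<^sup>2"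
  proof -
    have "(norm S')\<^sup>2 \<le> c\<^sup>2 * (n - \<alpha>\<^sup>2 - d) - s\<^sup>2 / n"
      using nS SS by (simp add: power2_norm_eq_inner n_def)
    also have "\<dots> = c\<^sup>2 * ((n - \<alpha>\<^sup>2) * \<alpha>\<^sup>2 / n - d)"
      using n0 by (simp add: s power2_eq_square field_simps)
    also have "\<dots> \<le> c\<^sup>2 * ((n - \<alpha>\<^sup>2) * (\<alpha> - h)\<^sup>2 / n)"
    proof (rule mult_left_mono)
      \<comment> \<open>Here \<open>2 * \<alpha> * h - h\<^sup>2\<close> is the loss from replacing
        \<open>\<alpha>\<^sup>2\<close> by \<open>(\<alpha> - h)\<^sup>2\<close>; the deficit
        \<open>d\<close> pays for it.\<close>
      have "(n - \<alpha>\<^sup>2) / n * (2 * \<alpha> * h - h\<^sup>2) \<le> 1 * (2 * \<alpha> * h - h\<^sup>2)"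
        using n1 a2 h mult_right_mono[of h "2 * \<alpha>" h] by (intro mult_right_mono) (auto simp: power2_eq_square)
      also have "\<dots> \<le> d" using h(3) by (smt (verit) zero_le_power2)
      finally have "(n - \<alpha>\<^sup>2) / n * (2 * \<alpha> * h - h\<^sup>2) \<le> d" .
      moreover have "(n - \<alpha>\<^sup>2) * (\<alpha> - h)\<^sup>2 / n = (n - \<alpha>\<^sup>2) * \<alpha>\<^sup>2 / n - (n - \<alpha>\<^sup>2) / n * (2 * \<alpha> * h - h\<^sup>2)"
        using n0 by (simp add: field_simps power2_eq_square)
      ultimately show "(n - \<alpha>\<^sup>2) * \<alpha>\<^sup>2 / n - d \<le> (n - \<alpha>\<^sup>2) * (\<alpha> - h)\<^sup>2 / n" by linarith
    qed simp
    finally have "(norm S')\<^sup>2 * ((n - \<alpha>\<^sup>2) / n) \<le> c\<^sup>2 * ((n - \<alpha>\<^sup>2) * (\<alpha> - h)\<^sup>2 / n) * ((n - \<alpha>\<^sup>2) / n)"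
      using n1 a2 by (intro mult_right_mono) auto
    also have "\<dots> = (s * (\<alpha> - h) / n)\<^sup>2"
      by (simp add: s power2_eq_square)
    finally show ?thesis .
  qed
  ultimately have "(norm M')\<^sup>2 * (norm S')\<^sup>2 \<le> (norm M)\<^sup>2 * (s * (\<alpha> - h) / n)\<^sup>2"
  proof -
    assume 1: "(norm M')\<^sup>2 \<le> (norm M)\<^sup>2 * ((n - \<alpha>\<^sup>2) / n)"
      and 2: "(norm S')\<^sup>2 * ((n - \<alpha>\<^sup>2) / n) \<le> (s * (\<alpha> - h) / n)\<^sup>2"
    have "(norm M')\<^sup>2 * (norm S')\<^sup>2 \<le> (norm M)\<^sup>2 * ((n - \<alpha>\<^sup>2) / n) * (norm S')\<^sup>2"
      using 1 by (rule mult_right_mono) simp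
    also have "\<dots> = (norm M)\<^sup>2 * ((norm S')\<^sup>2 * ((n - \<alpha>\<^sup>2) / n))" by simp
    also have "\<dots> \<le> (norm M)\<^sup>2 * (s * (\<alpha> - h) / n)\<^sup>2"
      using 2 by (rule mult_left_mono) simp
    finally show ?thesis .
  qed
  then have "(norm M' * norm S')\<^sup>2 \<le> (norm M * (s * (\<alpha> - h) / n))\<^sup>2"
    by (simp only: power_mult_distrib)
  then have "norm M' * norm S' \<le> norm M * (s * (\<alpha> - h) / n)"
    by (rule power2_le_imp_le) (use s0 h n1 in auto)
  moreover have "- (norm M' * norm S') \<le> M' \<bullet> S'"
    using Cauchy_Schwarz_ineq2[of M' S'] by linarith
  moreover have "\<alpha> * norm M * s / n \<le> m * s / n"
    using m0 s0 n1 by (intro divide_right_mono mult_right_mono) auto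
  ultimately have "\<alpha> * norm M * s / n - norm M * (s * (\<alpha> - h) / n) \<le> M \<bullet> S"
    unfolding MS by (metis (no_types, opaque_lifting) add_mono diff_conv_add_uminus le_minus_iff minus_minus order_trans)
  then show ?thesis
    using n0 by (simp add: s_def n_def field_simps)
qed

subsection \<open>The quadratic along the step\<close>

text \<open>With \<open>curv\<close>, this gives the step quadratic: for the \<open>Q\<close>
  considered below, the squared norm of \<open>(mat 1 + u *\<^sub>R Q) ** (mat 1 - Q)\<close> is a
  constant minus \<open>2 * u * slope Q\<close> plus \<open>u\<^sup>2 * curv Q\<close>.\<close>

definition slope :: "real^'n^'n \<Rightarrow> real" where
  "slope Q = Q \<bullet> (Q - Q ** Q)"

definition curv :: "real^'n^'n \<Rightarrow> real" where
  "curv Q = (Q - Q ** Q) \<bullet> (Q - Q ** Q)"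

context
  fixes Q :: "real^'n^'n" and \<alpha> :: real
  assumes symQ: "symm Q" and trQ: "trace Q = \<alpha>\<^sup>2" and nQ: "Q \<bullet> Q = \<alpha>\<^sup>2"
    and a: "0 < \<alpha>" "\<alpha> < 1"
begin

lemma norm_Q: "norm Q = \<alpha>"
  using a by (simp add: norm_eq_sqrt_inner nQ)

lemma norm_Q_square_le: "norm (Q ** Q) \<le> \<alpha>\<^sup>2"
  using norm_matrix_mult_le[of Q Q] by (simp add: norm_Q power2_eq_square)

lemma Q_cube_bound: "\<bar>Q \<bullet> (Q ** Q)\<bar> \<le> \<alpha> ^ 3"
proof -
  have "\<bar>Q \<bullet> (Q ** Q)\<bar> \<le> norm Q * norm (Q ** Q)"
    by (rule Cauchy_Schwarz_ineq2)
  also have "\<dots> \<le> \<alpha> * \<alpha>\<^sup>2"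
    using a norm_Q norm_Q_square_le by (intro mult_mono) auto
  finally show ?thesis by (simp add: power2_eq_square power3_eq_cube)
qed

lemma Q_fourth_bound: "(Q ** Q) \<bullet> (Q ** Q) \<le> \<alpha> ^ 4"
  using power_mono[OF norm_Q_square_le, of 2] by (simp add: power2_norm_eq_inner flip: power_mult)

lemma trace_Q_powers:
  "trace (Q ** Q) = \<alpha>\<^sup>2"
  "trace (Q ** Q ** Q) = Q \<bullet> (Q ** Q)"
  "trace (Q ** Q ** Q ** Q) = (Q ** Q) \<bullet> (Q ** Q)"
proof -
  show "trace (Q ** Q) = \<alpha>\<^sup>2" "trace (Q ** Q ** Q) = Q \<bullet> (Q ** Q)"
    using trace_mult_symm[OF symQ, of Q] trace_mult_symm[OF symQ, of "Q ** Q"]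
    by (simp_all add: nQ matrix_mul_assoc)
  show "trace (Q ** Q ** Q ** Q) = (Q ** Q) \<bullet> (Q ** Q)"
    using trace_mult_symm[OF symm_square[OF symQ], of "Q ** Q"] by (simp add: matrix_mul_assoc)
qed

lemma slope_eq: "slope Q = \<alpha>\<^sup>2 - Q \<bullet> (Q ** Q)"
  by (simp add: slope_def inner_diff_right nQ)

lemma curv_eq: "curv Q = \<alpha>\<^sup>2 - 2 * (Q \<bullet> (Q ** Q)) + (Q ** Q) \<bullet> (Q ** Q)"
  by (simp add: curv_def inner_diff_left inner_diff_right nQ inner_commute[of "Q ** Q" Q])

lemma slope_ge: "\<alpha>\<^sup>2 * (1 - \<alpha>) \<le> slope Q"
  using Q_cube_bound by (simp add: slope_eq power2_eq_square power3_eq_cube algebra_simps)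

lemma slope_pos: "0 < slope Q"
proof -
  have "0 < \<alpha>\<^sup>2 * (1 - \<alpha>)" using a by simp
  with slope_ge show ?thesis by linarith
qed

lemma curv_pos: "0 < curv Q"
  using slope_pos by (auto simp: curv_def slope_def)

text \<open>With q3 and q4 the traces of the third and fourth powers of \<open>Q\<close>, right
  minus left is \<open>\<alpha> ^ 3\<close> plus \<open>1 - \<alpha>\<close> times q3 minus q4,
  nonnegative by the bounds above. Hence the minimiser \<open>slope Q / curv Q\<close> is at least
  \<open>1 / (1 + \<alpha>)\<close>.\<close>

lemma curv_le: "curv Q \<le> (1 + \<alpha>) * slope Q"
proof -
  have "(1 - \<alpha>) * - (\<alpha> ^ 3) \<le> (1 - \<alpha>) * (Q \<bullet> (Q ** Q))"
    using a Q_cube_bound by (intro mult_left_mono) auto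
  with Q_fourth_bound show ?thesis
    by (simp add: slope_eq curv_eq power2_eq_square power3_eq_cube power4_eq_xxxx algebra_simps)
qed

lemma trace_shift: "trace ((mat 1 + u *\<^sub>R Q) ** (mat 1 - Q)) = real CARD('n) - \<alpha>\<^sup>2"
  by (simp add: matrix_ring_simps trace_I trQ trace_Q_powers)

lemma shift_expand: "(mat 1 + u *\<^sub>R Q) ** (mat 1 - Q) = (mat 1 - Q) + u *\<^sub>R (Q - Q ** Q)"
  by (simp add: matrix_ring_simps algebra_simps)

text \<open>Symmetry lets the trace of the squared matrix be read as a squared Frobenius
  norm.\<close>

lemma symm_shift: "symm ((mat 1 + u *\<^sub>R Q) ** (mat 1 - Q))"
  unfolding shift_expand by (intro symm_add symm_diff symm_scaleR symm_square symQ symm_mat_1)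

lemma inner_shift:
  "((mat 1 + u *\<^sub>R Q) ** (mat 1 - Q)) \<bullet> ((mat 1 + u *\<^sub>R Q) ** (mat 1 - Q))
    = real CARD('n) - \<alpha>\<^sup>2 - 2 * u * slope Q + u\<^sup>2 * curv Q"
proof -
  have 1: "(mat 1 - Q) \<bullet> (mat 1 - Q) = real CARD('n) - \<alpha>\<^sup>2"
    by (simp add: inner_diff_left inner_diff_right trace_I inner_mat_1 inner_commute[of Q "mat 1"] trQ nQ)
  have 2: "(mat 1 - Q) \<bullet> (Q - Q ** Q) = - slope Q"
    by (simp add: inner_diff_left inner_mat_1 trace_sub trQ trace_Q_powers slope_def)
  show ?thesis
    unfolding shift_expand inner_add_scaleR_self 1 2 curv_def by simp
qed

text \<open>A symmetric matrix \<open>M\<close> that kills a unit vector satisfies \<open>(trace M)\<^sup>2 \<le> (n - 1) |M|\<^sup>2\<close>.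
  Along the segment up to the minimiser, \<open>M = (I + w Q) (I - Q)\<close> has
  \<open>(trace M)\<^sup>2 \<ge> (n - \<alpha>\<^sup>2) |M|\<^sup>2\<close>, so that \<open>I + w Q\<close> never becomes singular there.\<close>

lemma posdef_shift:
  assumes u: "0 < u" "u * curv Q \<le> slope Q"
  shows "posdef (mat 1 + u *\<^sub>R Q)"
proof -
  let ?f = "\<lambda>x::real^'n. x \<bullet> (Q *v x)"
  have a2: "\<alpha>\<^sup>2 < 1" using a by (simp add: power_less_one_iff)
  have card: "1 \<le> real CARD('n)" by (simp add: Suc_leI)
  have "compact (sphere (0::real^'n) 1)" "sphere (0::real^'n) 1 \<noteq> {}"
    by auto
  moreover have "continuous_on (sphere 0 1) ?f"
    by (intro continuous_intros linear_continuous_on linear_linear[THEN iffD2]) auto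
  ultimately obtain v where v: "v \<in> sphere 0 1" "\<And>x. x \<in> sphere 0 1 \<Longrightarrow> ?f v \<le> ?f x"
    using continuous_attains_inf[of "sphere 0 1" ?f] by blast
  \<comment> \<open>The minimum of the Rayleigh quotient of \<open>Q\<close>; the claim reduces to
    \<open>1 + u * m > 0\<close>.\<close>
  define m where "m = ?f v"
  have vv: "v \<bullet> v = 1" using v by (simp add: norm_eq_1)
  have ge: "m * (x \<bullet> x) \<le> ?f x" for x
  proof (cases "x = 0")
    case False
    have "m \<le> ?f ((1 / norm x) *\<^sub>R x)"
      unfolding m_def by (rule v(2)) (use False in simp)
    also have "\<dots> = ?f x / (x \<bullet> x)"
      by (simp add: matrix_vector_mult_scaleR power2_norm_eq_inner[symmetric] power2_eq_square)
    finally show ?thesis using False by (simp add: pos_le_divide_eq)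
  qed simp
  have pos: "1 + u * m > 0"
  proof (rule ccontr)
    assume neg: "\<not> 1 + u * m > 0"
    then have m: "m < 0" using u(1) by (smt (verit) mult_nonneg_nonneg)
    have eig: "Q *v v = m *\<^sub>R v"
    proof -
      \<comment> \<open>The residual of the eigenvalue equation. Comparing \<open>v\<close> with
        \<open>v - e *\<^sub>R w\<close> gives a quadratic in \<open>e\<close> that is nonnegative,
        vanishes at 0 and has slope \<open>- 2 * (w \<bullet> w)\<close> there, so
        \<open>w = 0\<close>.\<close>
      define w where "w = Q *v v - m *\<^sub>R v"
      have vw: "v \<bullet> w = 0" using vv by (simp add: w_def inner_diff_right m_def)
      have Qvw: "v \<bullet> (Q *v w) = w \<bullet> w"
        using symm_inner_mult[OF symQ, of v w] vw
        by (simp add: w_def inner_diff_right inner_diff_left inner_commute)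
      define g where "g = ?f w - m * (w \<bullet> w)"
      have g0: "g \<ge> 0" using ge by (simp add: g_def)
      have "0 \<le> - 2 * e * (w \<bullet> w) + e\<^sup>2 * g" for e
      proof -
        have wQv: "w \<bullet> (Q *v v) = w \<bullet> w"
          using symm_inner_mult[OF symQ, of w v] Qvw by (simp add: inner_commute)
        have "m * ((v - e *\<^sub>R w) \<bullet> (v - e *\<^sub>R w)) = m + m * e\<^sup>2 * (w \<bullet> w)"
          using vv vw inner_add_scaleR_self[of v "- e" w] by (simp add: distrib_left)
        moreover have "?f (v - e *\<^sub>R w) = m - 2 * e * (w \<bullet> w) + e\<^sup>2 * ?f w"
          using wQv Qvw by (simp add: inner_diff_left inner_diff_right matrix_vector_mult_diff_distrib
            matrix_vector_mult_scaleR power2_eq_square m_def algebra_simps)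
        ultimately show ?thesis
          using ge[of "v - e *\<^sub>R w"] by (simp add: g_def algebra_simps)
      qed
      note quad = this
      have "w \<bullet> w = 0"
      proof (rule ccontr)
        assume "w \<bullet> w \<noteq> 0"
        then have W: "w \<bullet> w > 0" by simp
        define e where "e = (w \<bullet> w) / (g + 1)"
        have e: "e > 0" using W g0 by (simp add: e_def)
        have "e * (g + 1) = w \<bullet> w" using g0 by (simp add: e_def)
        then have "e * g = w \<bullet> w - e" by (simp add: distrib_left)
        then have "- 2 * (w \<bullet> w) + e * g < 0" using W e by linarith
        then have "e * (- 2 * (w \<bullet> w) + e * g) < 0" using e by (rule mult_pos_neg[rotated])
        moreover have "e * (- 2 * (w \<bullet> w) + e * g) = - 2 * e * (w \<bullet> w) + e\<^sup>2 * g"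
          by (simp add: power2_eq_square right_diff_distrib)
        ultimately show False using quad[of e] by linarith
      qed
      then show ?thesis by (simp add: w_def)
    qed
    \<comment> \<open>The parameter at which \<open>mat 1 + w *\<^sub>R Q\<close> kills
      \<open>v\<close>; it is at most \<open>u\<close> because
      \<open>1 + u * m \<le> 0\<close>.\<close>
    define w where "w = - 1 / m"
    have w: "0 < w" "w \<le> u" "1 + w * m = 0"
      using m neg u(1) by (auto simp: w_def field_simps)
    let ?M = "(mat 1 + w *\<^sub>R Q) ** (mat 1 - Q)"
    \<comment> \<open>The orthogonal projection onto the line of \<open>v\<close>. As
      \<open>?M\<close> kills \<open>v\<close>, its trace is its inner product with
      \<open>mat 1 - V\<close>, whose squared norm is n - 1.\<close>
    define V :: "real^'n^'n" where "V = (\<chi> i j. v $ i * v $ j)"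
    have V: "N \<bullet> V = v \<bullet> (N *v v)" for N :: "real^'n^'n"
      by (simp add: V_def inner_vec_def matrix_vector_mult_def sum_distrib_left algebra_simps)
    have Vv: "V *v v = v"
      using vv by (simp add: V_def vec_eq_iff matrix_vector_mult_def inner_vec_def mult.assoc flip: sum_distrib_left)
    have "?M *v v = (mat 1 + w *\<^sub>R Q) *v ((1 - m) *\<^sub>R v)"
      by (simp add: eig algebra_simps flip: matrix_vector_mul_assoc)
    also have "\<dots> = (1 - m) *\<^sub>R ((1 + w * m) *\<^sub>R v)"
      by (simp add: eig matrix_vector_mult_scaleR matrix_vector_mult_add_rdistrib algebra_simps flip: scaleR_matrix_vector_assoc)
    finally have MV: "?M \<bullet> V = 0" by (simp add: V w)
    have "real CARD('n) - \<alpha>\<^sup>2 = ?M \<bullet> (mat 1 - V)"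
      using trace_shift[of w] by (simp add: inner_diff_right MV inner_commute[of ?M "mat 1"] inner_mat_1)
    moreover have "?M \<bullet> (mat 1 - V) \<le> norm ?M * norm (mat 1 - V)"
      by (rule norm_cauchy_schwarz)
    moreover have "real CARD('n) - \<alpha>\<^sup>2 > 0"
      using a2 card by linarith
    ultimately have "(real CARD('n) - \<alpha>\<^sup>2)\<^sup>2 \<le> (norm ?M * norm (mat 1 - V))\<^sup>2"
      by (intro power_mono) auto
    also have "\<dots> = (?M \<bullet> ?M) * ((mat 1 - V) \<bullet> (mat 1 - V))"
      by (simp add: power_mult_distrib power2_norm_eq_inner)
    also have "(mat 1 - V) \<bullet> (mat 1 - V) = real CARD('n) - 1"
      using vv Vv by (simp add: inner_diff_left inner_diff_right norm_mat_1_sq V inner_commute[of V "mat 1"]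
          matrix_vector_mult_diff_rdistrib)
    also have "(?M \<bullet> ?M) * (real CARD('n) - 1) \<le> (real CARD('n) - \<alpha>\<^sup>2) * (real CARD('n) - 1)"
    proof (rule mult_right_mono)
      \<comment> \<open>Up to its minimiser the quadratic of \<open>inner_shift\<close> stays below
        its value at 0.\<close>
      have "w * curv Q \<le> slope Q"
        using w(2) u(2) curv_pos mult_right_mono[of w u "curv Q"] by linarith
      then have "w * (w * curv Q) \<le> w * slope Q" using w by (intro mult_left_mono) auto
      moreover have "0 < w * slope Q" using w slope_pos by simp
      ultimately have "w\<^sup>2 * curv Q \<le> 2 * w * slope Q"
        by (simp add: power2_eq_square mult.assoc)
      then show "?M \<bullet> ?M \<le> real CARD('n) - \<alpha>\<^sup>2" unfolding inner_shift by linarith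
    qed (simp add: Suc_leI)
    finally have "real CARD('n) - \<alpha>\<^sup>2 \<le> real CARD('n) - 1"
      using \<open>real CARD('n) - \<alpha>\<^sup>2 > 0\<close> by (simp add: power2_eq_square)
    then show False using a2 by simp
  qed
  show ?thesis
    unfolding posdef_def
  proof (intro conjI allI impI)
    show "symm (mat 1 + u *\<^sub>R Q)" by (intro symm_add symm_scaleR symQ symm_mat_1)
    fix x :: "real^'n" assume x: "x \<noteq> 0"
    have "0 < (1 + u * m) * (x \<bullet> x)" using pos x by simp
    also have "\<dots> = x \<bullet> x + u * (m * (x \<bullet> x))" by (simp add: algebra_simps)
    also have "\<dots> \<le> x \<bullet> x + u * ?f x" using ge u(1) by simp
    also have "\<dots> = x \<bullet> ((mat 1 + u *\<^sub>R Q) *v x)"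
      by (simp add: matrix_vector_mult_add_rdistrib inner_add_right flip: scaleR_matrix_vector_assoc)
    finally show "0 < x \<bullet> ((mat 1 + u *\<^sub>R Q) *v x)" .
  qed
qed

end

subsection \<open>Structure and existence of optimal solutions\<close>

locale sdp =
  fixes C :: "real^'n^'n" and A :: "'m::finite \<Rightarrow> real^'n^'n" and b :: "real^'m" and \<alpha> :: real
  assumes symC: "symm C" and symA: "\<And>i. symm (A i)"
    and b_nz: "b \<noteq> 0"
    and C_notin: "\<nexists>y. C = Aadj A y"
    and A_indep: "\<And>y. Aadj A y = 0 \<Longrightarrow> y = 0"
    and alpha: "0 < \<alpha>" "\<alpha> < 1"
begin

lemma alpha_sq: "0 < \<alpha>\<^sup>2" "\<alpha>\<^sup>2 < 1"
  using alpha by (simp_all add: power_less_one_iff)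

lemma card_ge_1: "1 \<le> real CARD('n)"
  by (simp add: Suc_leI)

lemma card_minus_alpha_pos: "0 < real CARD('n) - \<alpha>\<^sup>2"
  using alpha_sq card_ge_1 by linarith

section \<open>The constraint operator and its adjoint\<close>

lemma linear_Aop: "linear (Aop A)"
  by (rule linearI) (simp_all add: Aop_def vec_eq_iff matrix_ring_simps)

lemma linear_Aadj: "linear (Aadj A)"
  by (rule linearI) (simp_all add: Aadj_def scaleR_left_distrib sum.distrib scaleR_sum_right)

lemma symm_Aadj: "symm (Aadj A y)"
proof -
  have "symm (\<Sum>i\<in>I. y $ i *\<^sub>R A i)" if "finite I" for I
    using that by induction (auto intro: symm_add symm_scaleR symA)
  then show ?thesis by (simp add: Aadj_def)
qed

lemma trace_Aadj: "trace (Aadj A y ** X) = Aop A X \<bullet> y"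
proof -
  have "trace (Aadj A y ** X) = Aadj A y \<bullet> X"
    by (rule trace_mult_symm[OF symm_Aadj])
  also have "\<dots> = (\<Sum>i\<in>UNIV. y $ i * (A i \<bullet> X))"
    by (simp add: Aadj_def inner_sum_left)
  also have "\<dots> = Aop A X \<bullet> y"
    by (simp add: Aop_def inner_vec_def trace_mult_symm[OF symA] mult.commute)
  finally show ?thesis .
qed

text \<open>Pairing the dual equation with \<open>X\<close>; no cone membership enters, so one dual
  pair can be tested at the points of successive iterates.\<close>

lemma objective_eq:
  assumes "Aadj A y + S = C" "Aop A X = b"
  shows "trace (C ** X) = b \<bullet> y + trace (X ** S)"
proof -
  have "trace (C ** X) = trace (Aadj A y ** X) + trace (S ** X)"
    unfolding assms(1)[symmetric] by (simp add: matrix_ring_simps)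
  then show ?thesis
    by (simp add: trace_Aadj assms trace_mul_sym[of S])
qed

text \<open>The part \<open>q\<close> of \<open>M\<close> orthogonal to the range is symmetric and
  in the kernel of \<open>Aop A\<close>, so \<open>perp\<close> makes it orthogonal to
  \<open>M\<close>, hence to itself.\<close>

lemma Aadj_range:
  assumes "symm M" and perp: "\<And>D. symm D \<Longrightarrow> Aop A D = 0 \<Longrightarrow> trace (M ** D) = 0"
  shows "\<exists>y. M = Aadj A y"
proof -
  have sub: "subspace (range (Aadj A))"
    using linear_Aadj linear_subspace_image subspace_UNIV by blast
  obtain p q where p: "p \<in> span (range (Aadj A))"
    and q: "\<And>w. w \<in> span (range (Aadj A)) \<Longrightarrow> orthogonal q w" and M: "M = p + q"
    using orthogonal_subspace_decomp_exists by blast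
  from p obtain y where y: "p = Aadj A y"
    using sub by (metis imageE span_eq_iff)
  have "q = M - p" using M by simp
  then have symq: "symm q" using assms(1) symm_Aadj by (simp add: y symm_diff)
  have qA: "q \<bullet> Aadj A z = 0" for z
    using q[of "Aadj A z"] by (simp add: orthogonal_def span_base)
  have "Aop A q \<bullet> z = 0" for z
    using qA[of z] trace_Aadj[of z q] trace_mult_symm[OF symm_Aadj, of z q]
    by (simp add: inner_commute)
  then have "Aop A q = 0" by (metis inner_eq_zero_iff)
  then have "M \<bullet> q = 0"
    using perp[OF symq] assms(1) by (simp add: trace_mult_symm)
  moreover have "p \<bullet> q = 0" using qA[of y] by (simp add: y inner_commute)
  ultimately have "q = 0" using M by (simp add: inner_add_left)
  then show ?thesis using M y by auto
qed

text \<open>First-order optimality in the coordinates \<open>H\<close> of \<open>X\<close>: on the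
  tangent space \<open>L\<close> of the constraints, the objective is a nonnegative multiple of
  \<open>l\<close>, half the derivative of the squared cone condition. That multiple yields the dual
  slack.\<close>

lemma optimal_structure:
  fixes R T :: "real^'n^'n"
  assumes RT: "R ** T = mat 1" and TR: "T ** R = mat 1"
    and feasE: "Aop A (R ** transpose R) = b"
    and opt: "QP_opt C A b (R ** transpose R) \<alpha> X"
  obtains k c Q y where "k > 0" "c > 0" "symm Q" "trace Q = \<alpha>\<^sup>2" "Q \<bullet> Q = \<alpha>\<^sup>2"
    "X = k *\<^sub>R (R ** Q ** transpose R)"
    "Aadj A y + c *\<^sub>R (transpose T ** (mat 1 - Q) ** T) = C"
proof -
  note cong = congruence_inverse[OF RT TR]
  let ?E = "R ** transpose R"
  let ?r = "\<lambda>M. R ** M ** transpose R"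
  have lin_r: "linear ?r"
    by (rule linearI) (simp_all add: matrix_ring_simps)
  define H where "H = T ** X ** transpose T"
  have X: "X = ?r H" by (simp add: H_def cong)
  have AX: "Aop A X = b" and "X \<in> KE ?E \<alpha>"
    using opt by (auto simp: QP_opt_def QP_feas_def)
  then have symH: "symm H" and H: "\<alpha> * norm H \<le> trace H"
    using KE_factor[OF RT TR, of H \<alpha>] by (auto simp: X)
  have "H \<noteq> 0"
  proof
    assume "H = 0"
    then have "X = 0" using linear_0[OF lin_r] by (simp add: X)
    then show False using AX b_nz linear_0[OF linear_Aop] by simp
  qed
  then have "0 < \<alpha> * norm H" using alpha by simp
  then have trH: "trace H > 0" using H by linarith
  define L where "L = {D. symm D \<and> Aop A (?r D) = 0}"
  define f where "f = (\<lambda>D. trace (C ** ?r D))"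
  have lin_Ar: "linear (\<lambda>D. Aop A (?r D))"
    using linear_compose[OF lin_r linear_Aop] by (simp add: o_def)
  have subL: "subspace L"
    unfolding L_def subspace_def
    by (auto simp: symm_add symm_scaleR linear_0[OF linear_Aop] linear_add[OF lin_Ar] linear_cmul[OF lin_Ar])
  have lin_f: "linear f"
    unfolding f_def by (rule linearI) (simp_all add: matrix_ring_simps)
  have descent: "f D \<ge> 0" if D: "D \<in> L"
    and dir: "\<alpha> * norm H < trace H \<or> trace H * trace D - \<alpha>\<^sup>2 * (H \<bullet> D) > 0" for D
  proof -
    obtain e where e: "e > 0" "\<alpha> * norm (H + e *\<^sub>R D) \<le> trace (H + e *\<^sub>R D)"
      using cone_feasible_direction[OF trH alpha(1) H dir] by blast
    have "?r (H + e *\<^sub>R D) \<in> KE ?E \<alpha>"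
      using D e symH by (simp add: KE_factor[OF RT TR] L_def symm_add symm_scaleR)
    moreover have "Aop A (?r (H + e *\<^sub>R D)) = b"
      using D AX by (simp add: linear_add[OF lin_Ar] linear_cmul[OF lin_Ar] L_def X)
    ultimately have "trace (C ** X) \<le> f (H + e *\<^sub>R D)"
      using opt by (simp add: QP_opt_def QP_feas_def f_def)
    then have "0 \<le> e * f D"
      by (simp add: linear_add[OF lin_f] linear_cmul[OF lin_f]) (simp add: f_def X)
    then show ?thesis using e by (simp add: zero_le_mult_iff)
  qed
  \<comment> \<open>A matrix \<open>N\<close> that represents the objective on \<open>L\<close> is a
    dual slack up to coordinates.\<close>
  have range: "\<exists>y. C - transpose T ** N ** T = Aadj A y"
    if symN: "symm N" and N: "\<And>D. D \<in> L \<Longrightarrow> f D = trace (N ** D)" for N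
  proof (rule Aadj_range)
    show "symm (C - transpose T ** N ** T)"
      using symm_congruence[OF symN, of "transpose T"] symC by (simp add: symm_diff)
    fix D assume D: "symm D" "Aop A D = 0"
    define D' where "D' = T ** D ** transpose T"
    have rD: "?r D' = D" by (simp add: D'_def cong)
    have "D' \<in> L" using D rD by (simp add: L_def) (simp add: D'_def symm_congruence)
    from N[OF this] have "trace (C ** D) = trace (N ** D')" by (simp add: f_def rD)
    also have "\<dots> = trace (transpose T ** N ** T ** D)"
      using trace_congruence[of "transpose T" N D] by (simp add: D'_def)
    finally show "trace ((C - transpose T ** N ** T) ** D) = 0"
      by (simp add: matrix_ring_simps)
  qed
  \<comment> \<open>From an interior point every direction and its negative are feasible, so the
    objective would vanish on \<open>L\<close>, and \<open>C\<close> would be in the range of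
    \<open>Aadj A\<close>.\<close>
  have bdry: "\<alpha> * norm H = trace H"
  proof (rule ccontr)
    assume "\<alpha> * norm H \<noteq> trace H"
    then have int: "\<alpha> * norm H < trace H" using H by simp
    have "f D = 0" if "D \<in> L" for D
      using descent[of D] descent[of "- D"] that int subspace_neg[OF subL that]
      by (simp add: linear_neg[OF lin_f])
    then have "\<exists>y. C - transpose T ** 0 ** T = Aadj A y"
      by (intro range) (auto simp: trace_def)
    then show False using C_notin by simp
  qed
  have sqH: "\<alpha>\<^sup>2 * (H \<bullet> H) = (trace H)\<^sup>2"
    unfolding bdry[symmetric] by (simp add: power_mult_distrib power2_norm_eq_inner)
  define l where "l = (\<lambda>D. trace H * trace D - \<alpha>\<^sup>2 * (H \<bullet> D))"
  have lin_l: "linear l"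
    unfolding l_def by (rule linearI) (simp_all add: trace_add trace_scaleR inner_add_right distrib_left right_diff_distrib)
  \<comment> \<open>The direction from \<open>X\<close> to \<open>E\<close>, which points into the
    cone.\<close>
  have D0: "mat 1 - H \<in> L"
    using symH feasE AX by (simp add: L_def symm_diff linear_diff[OF lin_Ar] X)
  have "l (mat 1 - H) = trace H * (real CARD('n) - \<alpha>\<^sup>2)"
  proof -
    have "H \<bullet> mat 1 = trace H" by (simp add: inner_commute[of H] inner_mat_1)
    then have "l (mat 1 - H) = trace H * (real CARD('n) - trace H) - \<alpha>\<^sup>2 * trace H + \<alpha>\<^sup>2 * (H \<bullet> H)"
      by (simp add: l_def trace_sub trace_I inner_diff_right right_diff_distrib)
    then show ?thesis
      unfolding sqH by (simp add: power2_eq_square right_diff_distrib)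
  qed
  then have l0: "l (mat 1 - H) > 0"
    using trH card_minus_alpha_pos by simp
  obtain r where r: "r \<ge> 0" "\<And>D. D \<in> L \<Longrightarrow> f D = r * l D"
    using functional_proportional[OF subL lin_f lin_l D0 l0] descent unfolding l_def by blast
  \<comment> \<open>The scale makes \<open>trace Q = \<alpha>\<^sup>2\<close>, and
    \<open>sqH\<close> gives \<open>Q \<bullet> Q\<close> the same value; \<open>c\<close> then
    turns \<open>r * l D\<close> into \<open>c * (trace D - Q \<bullet> D)\<close>.\<close>
  define Q where "Q = (\<alpha>\<^sup>2 / trace H) *\<^sub>R H"
  define c where "c = r * trace H"
  have symQ: "symm Q" by (simp add: Q_def symm_scaleR symH)
  have trQ: "trace Q = \<alpha>\<^sup>2" using trH by (simp add: Q_def trace_scaleR)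
  have "Q \<bullet> Q = \<alpha>\<^sup>2 / (trace H)\<^sup>2 * (\<alpha>\<^sup>2 * (H \<bullet> H))"
    by (simp add: Q_def power2_eq_square)
  then have nQ: "Q \<bullet> Q = \<alpha>\<^sup>2" using trH by (simp add: sqH)
  have "\<exists>y. C - transpose T ** (c *\<^sub>R (mat 1 - Q)) ** T = Aadj A y"
  proof (rule range)
    show "symm (c *\<^sub>R (mat 1 - Q))" by (simp add: symm_scaleR symm_diff symQ)
    fix D assume "D \<in> L"
    have "trace (c *\<^sub>R (mat 1 - Q) ** D) = c * (trace D - Q \<bullet> D)"
      by (simp add: matrix_ring_simps trace_mult_symm[OF symQ])
    also have "\<dots> = r * l D"
      using trH by (simp add: c_def l_def Q_def right_diff_distrib)
    finally show "f D = trace (c *\<^sub>R (mat 1 - Q) ** D)"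
      using r(2)[OF \<open>D \<in> L\<close>] by simp
  qed
  then obtain y where "C - transpose T ** (c *\<^sub>R (mat 1 - Q)) ** T = Aadj A y" by blast
  then have y: "Aadj A y + c *\<^sub>R (transpose T ** (mat 1 - Q) ** T) = C"
    by (simp add: matrix_ring_simps algebra_simps)
  have "c \<noteq> 0"
    using y C_notin by auto
  then have "c > 0" using r(1) trH by (simp add: c_def less_le)
  moreover have "X = (trace H / \<alpha>\<^sup>2) *\<^sub>R ?r Q"
    using trH alpha by (simp add: X Q_def matrix_ring_simps)
  moreover have "trace H / \<alpha>\<^sup>2 > 0" using trH alpha by simp
  ultimately show ?thesis
    using that symQ trQ nQ y by blast
qed

text \<open>The margin \<open>\<delta>\<close> makes the objective coercive: by
  \<open>objective_eq\<close> it grows at least like \<open>\<delta>\<close> times the local norm,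
  so its sublevel sets on the feasible set are compact.\<close>

lemma optimal_exists:
  assumes E: "posdef E" "Aop A E = b" and y: "Aadj A y + S = C"
    and d: "\<delta> > 0" and int: "\<And>X. X \<in> KE E \<alpha> \<Longrightarrow> \<delta> * normE E X \<le> trace (X ** S)"
  shows "E \<in> Swath C A b \<alpha>"
proof -
  obtain R T :: "real^'n^'n" where RT: "R ** T = mat 1" and TR: "T ** R = mat 1"
    and ER: "E = R ** transpose R"
    using posdef_factor[OF E(1)] by blast
  let ?r = "\<lambda>M. R ** M ** transpose R"
  define f where "f = (\<lambda>D. trace (C ** ?r D))"
  have lin_r: "linear ?r"
    by (rule linearI) (simp_all add: matrix_ring_simps)
  have lin_Ar: "linear (\<lambda>D. Aop A (?r D))"
    using linear_compose[OF lin_r linear_Aop] by (simp add: o_def)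
  have lin_f: "linear f"
    unfolding f_def by (rule linearI) (simp_all add: matrix_ring_simps)
  have cont_f: "continuous_on U f" for U
    by (intro linear_continuous_on linear_conv_bounded_linear[THEN iffD1] lin_f)
  have cont_Ar: "continuous_on U (\<lambda>D. Aop A (?r D))" for U
    by (intro linear_continuous_on linear_conv_bounded_linear[THEN iffD1] lin_Ar)
  have cont_t: "continuous_on U (\<lambda>D::real^'n^'n. transpose D)" for U
    by (intro linear_continuous_on linear_conv_bounded_linear[THEN iffD1] linearI)
       (simp_all add: transpose_add transpose_scalar)
  have cont_tr: "continuous_on U (\<lambda>D::real^'n^'n. trace D)" for U
    by (intro linear_continuous_on linear_conv_bounded_linear[THEN iffD1] linearI)
       (simp_all add: trace_add trace_scaleR)
  \<comment> \<open>In these coordinates \<open>mat 1\<close> is \<open>E\<close>, so only feasible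
    points no worse than \<open>E\<close> compete.\<close>
  define F where "F = {M. symm M \<and> \<alpha> * norm M \<le> trace M \<and> Aop A (?r M) = b \<and> f M \<le> f (mat 1)}"
  have "closed F"
    unfolding F_def symm_def
    by (intro closed_Collect_conj closed_Collect_eq closed_Collect_le continuous_intros
        cont_f cont_Ar cont_t cont_tr)
  moreover have "norm M \<le> (f (mat 1) - b \<bullet> y) / \<delta>" if "M \<in> F" for M
  proof -
    have M: "symm M" "\<alpha> * norm M \<le> trace M" "Aop A (?r M) = b" "f M \<le> f (mat 1)"
      using that by (auto simp: F_def)
    have "\<delta> * norm M \<le> trace (?r M ** S)"
      using int[of "?r M"] M by (simp add: ER KE_factor[OF RT TR] normE_factor[OF RT TR])
    also have "\<dots> = f M - b \<bullet> y"
      using objective_eq[OF y M(3)] by (simp add: f_def)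
    finally show ?thesis using M(4) d by (simp add: pos_le_divide_eq mult.commute)
  qed
  then have "bounded F" by (auto simp: bounded_iff)
  ultimately have "compact F" by (simp add: compact_eq_bounded_closed)
  moreover have one: "mat 1 \<in> F"
  proof -
    have "\<alpha> * sqrt (real CARD('n)) \<le> 1 * sqrt (real CARD('n))"
      using alpha by (intro mult_right_mono) auto
    also have "\<dots> \<le> sqrt (real CARD('n)) * sqrt (real CARD('n))"
      using card_ge_1 by (intro mult_right_mono) auto
    finally have "\<alpha> * sqrt (real CARD('n)) \<le> real CARD('n)" by simp
    then show ?thesis
      using E by (simp add: F_def ER norm_eq_sqrt_inner inner_mat_1 trace_I)
  qed
  ultimately obtain M where M: "M \<in> F" "\<And>N. N \<in> F \<Longrightarrow> f M \<le> f N"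
    using continuous_attains_inf[of F f] cont_f by blast
  have "QP_opt C A b E \<alpha> (?r M)"
    unfolding QP_opt_def QP_feas_def
  proof (intro conjI allI impI)
    show "Aop A (?r M) = b" "?r M \<in> KE E \<alpha>"
      using M(1) by (auto simp: F_def ER KE_factor[OF RT TR])
    fix X assume X: "Aop A X = b \<and> X \<in> KE E \<alpha>"
    define N where "N = T ** X ** transpose T"
    have XN: "X = ?r N" by (simp add: N_def congruence_inverse[OF RT TR])
    have "f M \<le> f N"
    proof (cases "f N \<le> f (mat 1)")
      case True
      then have "N \<in> F" using X by (simp add: F_def XN ER KE_factor[OF RT TR])
      then show ?thesis by (rule M(2))
    next
      case False
      then show ?thesis using M(2)[OF one] by simp
    qed
    then show "trace (C ** ?r M) \<le> trace (C ** X)" by (simp add: f_def XN)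
  qed
  then show ?thesis using E by (auto simp: Swath_def)
qed

end

subsection \<open>Uniqueness and the step\<close>

text \<open>Completing the square. The equivalence supplies the uniqueness that the definite
  description in \<open>tE\<close> calls for.\<close>

lemma quadratic_minimiser_iff:
  fixes p q :: real
  assumes "q > 0"
  shows "(\<forall>s. m - 2 * t * p + t\<^sup>2 * q \<le> m - 2 * s * p + s\<^sup>2 * q) \<longleftrightarrow> t = p / q"
proof -
  have sq: "m - 2 * s * p + s\<^sup>2 * q = m - p\<^sup>2 / q + q * (s - p / q)\<^sup>2" for s
    using assms by (simp add: power2_eq_square field_simps)
  show ?thesis
  proof
    assume "\<forall>s. m - 2 * t * p + t\<^sup>2 * q \<le> m - 2 * s * p + s\<^sup>2 * q"
    then have "q * (t - p / q)\<^sup>2 \<le> q * (p / q - p / q)\<^sup>2"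
      unfolding sq by (meson add_le_cancel_left)
    then show "t = p / q" using assms by (simp add: mult_le_0_iff)
  next
    assume "t = p / q"
    then show "\<forall>s. m - 2 * t * p + t\<^sup>2 * q \<le> m - 2 * s * p + s\<^sup>2 * q"
      unfolding sq using assms by simp
  qed
qed

text \<open>Fixes the data produced by \<open>optimal_structure\<close>; \<open>Swath_step\<close>
  later restates the results without it.\<close>

locale sdp_optimal = sdp C A b \<alpha>
  for C :: "real^'n^'n" and A :: "'m::finite \<Rightarrow> real^'n^'n" and b :: "real^'m" and \<alpha> :: real +
  fixes R T Q :: "real^'n^'n" and k c :: real and y :: "real^'m"
  assumes RT: "R ** T = mat 1" and TR: "T ** R = mat 1"
    and feasE: "Aop A (R ** transpose R) = b"
    and opt: "QP_opt C A b (R ** transpose R) \<alpha> (k *\<^sub>R (R ** Q ** transpose R))"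
    and k: "k > 0" and c: "c > 0"
    and symQ: "symm Q" and trQ: "trace Q = \<alpha>\<^sup>2" and nQ: "Q \<bullet> Q = \<alpha>\<^sup>2"
    and dual_eq: "Aadj A y + c *\<^sub>R (transpose T ** (mat 1 - Q) ** T) = C"
begin

abbreviation "E \<equiv> R ** transpose R"
abbreviation "X \<equiv> k *\<^sub>R (R ** Q ** transpose R)"
abbreviation "S \<equiv> c *\<^sub>R (transpose T ** (mat 1 - Q) ** T)"

lemmas Q = symQ trQ nQ alpha

lemma feasX: "Aop A X = b"
  using opt by (simp add: QP_opt_def QP_feas_def)

lemma pull_S: "transpose R ** S ** R = c *\<^sub>R (mat 1 - Q)"
  using congruence_inverse(3)[OF RT TR, of "mat 1 - Q"]
  by (simp add: matrix_scalar_ac scalar_matrix_assoc[symmetric])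

lemma trace_S: "trace (R ** M ** transpose R ** S) = c * (trace M - Q \<bullet> M)"
proof -
  have "trace (R ** M ** transpose R ** S) = trace (M ** (c *\<^sub>R (mat 1 - Q)))"
    by (simp only: trace_congruence pull_S)
  also have "\<dots> = c * (trace M - trace (Q ** M))"
    by (simp add: matrix_ring_simps trace_mul_sym[of M Q] right_diff_distrib)
  finally show ?thesis by (simp add: trace_mult_symm[OF symQ])
qed

text \<open>Complementary slackness: both terms of \<open>trace_S\<close> equal
  \<open>\<alpha>\<^sup>2\<close> at \<open>Q\<close>.\<close>

lemma trace_XS: "trace (X ** S) = 0"
proof -
  have "trace (X ** S) = k * trace (R ** Q ** transpose R ** S)"
    by (simp only: scalar_matrix_assoc[symmetric] trace_scaleR)
  then show ?thesis by (simp only: trace_S trQ nQ)  simp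
qed

lemma symm_S: "symm S"
  using symm_congruence[of "mat 1 - Q" "transpose T"] symQ by (simp add: symm_scaleR symm_diff)

lemma S_dual: "S \<in> KEdual E \<alpha>"
  unfolding KEdual_def
proof (intro CollectI conjI symm_S ballI)
  fix Z assume Z: "Z \<in> KE E \<alpha>"
  define M where "M = T ** Z ** transpose T"
  have ZM: "Z = R ** M ** transpose R"
    by (simp add: M_def congruence_inverse[OF RT TR])
  have "Q \<bullet> M \<le> \<alpha> * norm M"
    using norm_cauchy_schwarz[of Q M] by (simp add: norm_Q[OF Q])
  also have "\<dots> \<le> trace M"
    using Z by (simp add: ZM KE_factor[OF RT TR])
  finally show "0 \<le> trace (Z ** S)"
    unfolding ZM trace_S using c by simp
qed

section \<open>Weak duality and uniqueness of both optimal solutions\<close>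

lemma weak_duality:
  assumes "QPdual_feas C A E \<alpha> y' S'"
  shows "b \<bullet> y' \<le> b \<bullet> y"
proof -
  have "trace (C ** X) = b \<bullet> y' + trace (X ** S')"
    using assms feasX by (intro objective_eq) (auto simp: QPdual_feas_def)
  moreover have "trace (C ** X) = b \<bullet> y"
    using objective_eq[OF dual_eq feasX] trace_XS by simp
  moreover have "trace (X ** S') \<ge> 0"
    using assms opt by (auto simp: QPdual_feas_def KEdual_def QP_opt_def QP_feas_def)
  ultimately show ?thesis by linarith
qed

text \<open>A second optimum is also complementary to \<open>S\<close>, which forces equality in
  Cauchy-Schwarz between \<open>Q\<close> and \<open>M\<close>. So it is a multiple of
  \<open>X\<close>, and the constraint with \<open>b \<noteq> 0\<close> fixes the factor.\<close>

lemma primal_unique: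
  assumes "QP_opt C A b E \<alpha> X'"
  shows "X' = X"
proof -
  define M where "M = T ** X' ** transpose T"
  have XM: "X' = R ** M ** transpose R"
    by (simp add: M_def congruence_inverse[OF RT TR])
  have feas': "Aop A X' = b" and M: "\<alpha> * norm M \<le> trace M"
    using assms by (auto simp: QP_opt_def QP_feas_def XM KE_factor[OF RT TR])
  have "trace (C ** X') = trace (C ** X)"
    using assms opt by (intro antisym) (auto simp: QP_opt_def)
  then have "trace (X' ** S) = 0"
    using objective_eq[OF dual_eq feasX] objective_eq[OF dual_eq feas'] trace_XS by simp
  then have "trace M = Q \<bullet> M"
    unfolding XM trace_S using c by simp
  then have "Q \<bullet> M = norm Q * norm M"
    using M norm_cauchy_schwarz[of Q M] by (simp add: norm_Q[OF Q])
  then have "\<alpha> *\<^sub>R M = norm M *\<^sub>R Q"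
    unfolding norm_cauchy_schwarz_eq by (simp add: norm_Q[OF Q])
  then have "M = (norm M / \<alpha>) *\<^sub>R Q"
    using alpha by (metis divide_inverse_commute less_irrefl scaleR_left_imp_eq scaleR_one scaleR_scaleR right_inverse)
  then have X': "X' = (norm M / \<alpha> / k) *\<^sub>R X"
    unfolding XM using k
    by (metis (no_types, lifting) matrix_scalar_ac nonzero_eq_divide_eq order_less_irrefl scalar_matrix_assoc scaleR_scaleR)
  then have "b = (norm M / \<alpha> / k) *\<^sub>R b"
    using feas' feasX linear_cmul[OF linear_Aop] by metis
  then have "norm M / \<alpha> / k = 1"
    using b_nz by (metis scaleR_cancel_right scaleR_one)
  with X' show ?thesis by (simp only: scaleR_one)
qed

text \<open>\<open>S'\<close> is complementary to \<open>X\<close>, so \<open>N\<close> vanishes on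
  \<open>Q\<close> and is nonnegative along directions entering the cone there. The cone is smooth
  at \<open>Q\<close>, so \<open>N\<close> is a multiple of \<open>mat 1 - Q\<close>; a factor other
  than \<open>c\<close> would put \<open>C\<close> in the range of \<open>Aadj A\<close>.\<close>

lemma dual_unique:
  assumes "QPdual_feas C A E \<alpha> y' S'" "b \<bullet> y' = b \<bullet> y"
  shows "y' = y \<and> S' = S"
proof -
  have y': "Aadj A y' + S' = C" and symS': "symm S'"
    and S': "\<And>Z. Z \<in> KE E \<alpha> \<Longrightarrow> trace (Z ** S') \<ge> 0"
    using assms by (auto simp: QPdual_feas_def KEdual_def)
  define N where "N = transpose R ** S' ** R"
  have symN: "symm N"
    using symm_congruence[OF symS', of "transpose R"] by (simp add: N_def)
  have trN: "trace (R ** M ** transpose R ** S') = N \<bullet> M" for M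
    by (simp add: trace_congruence N_def[symmetric] trace_mul_sym[of M] trace_mult_symm[OF symN])
  have "trace (X ** S') = 0"
    using objective_eq[OF dual_eq feasX] objective_eq[OF y' feasX] trace_XS assms(2) by simp
  moreover have "trace (X ** S') = k * (N \<bullet> Q)"
    by (simp only: scalar_matrix_assoc[symmetric] trace_scaleR trN)
  ultimately have NQ: "N \<bullet> Q = 0" using k by simp
  have sub: "subspace {D :: real^'n^'n. symm D}"
    by (simp add: subspace_def symm_add symm_scaleR)
  have lin1: "linear (\<lambda>D. N \<bullet> D)"
    by (rule linearI) (simp_all add: inner_add_right)
  have lin2: "linear (\<lambda>D. trace D - Q \<bullet> D)"
    by (rule linearI) (simp_all add: trace_add trace_scaleR inner_add_right right_diff_distrib)
  have one: "trace (mat 1 :: real^'n^'n) - Q \<bullet> mat 1 > 0"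
    using card_minus_alpha_pos by (simp add: trace_I inner_commute[of Q] inner_mat_1 trQ)
  have pos: "N \<bullet> D \<ge> 0" if D: "D \<in> {D. symm D}" "trace D - Q \<bullet> D > 0" for D
  proof -
    have dir: "trace Q * trace D - \<alpha>\<^sup>2 * (Q \<bullet> D) > 0"
      using D alpha_sq by (simp add: trQ flip: right_diff_distrib)
    have "0 < trace Q" "\<alpha> * norm Q \<le> trace Q"
      using alpha by (auto simp: trQ norm_Q[OF Q] power2_eq_square)
    then obtain e where e: "e > 0" "\<alpha> * norm (Q + e *\<^sub>R D) \<le> trace (Q + e *\<^sub>R D)"
      using cone_feasible_direction[of Q \<alpha> D] alpha dir by blast
    then have "R ** (Q + e *\<^sub>R D) ** transpose R \<in> KE E \<alpha>"
      using D symQ by (simp add: KE_factor[OF RT TR] symm_add symm_scaleR)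
    from S'[OF this] have "0 \<le> e * (N \<bullet> D)"
      by (simp add: trN inner_add_right NQ)
    then show ?thesis using e by (simp add: zero_le_mult_iff)
  qed
  obtain r where r: "\<And>D. D \<in> {D. symm D} \<Longrightarrow> N \<bullet> D = r * (trace D - Q \<bullet> D)"
    using functional_proportional[OF sub lin1 lin2 _ one pos] by auto
  \<comment> \<open>Both matrices give the same functional on symmetric matrices; testing the
    difference on itself shows it is zero.\<close>
  define Z where "Z = N - r *\<^sub>R (mat 1 - Q)"
  have "symm Z" by (simp add: Z_def symm_diff symm_scaleR symN symQ)
  then have "Z \<bullet> Z = 0"
    using r[of Z] by (simp add: Z_def inner_diff_left inner_mat_1)
  then have "N = r *\<^sub>R (mat 1 - Q)" by (simp add: Z_def)
  then have "S' = transpose T ** (r *\<^sub>R (mat 1 - Q)) ** T"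
    using congruence_inverse(4)[OF RT TR, of S'] by (simp add: N_def)
  then have S'r: "S' = (r / c) *\<^sub>R S"
    using c by (simp add: matrix_scalar_ac scalar_matrix_assoc[symmetric])
  have "r = c"
  proof (rule ccontr)
    assume "r \<noteq> c"
    then have rc: "1 - r / c \<noteq> 0" using c by simp
    have "(1 - r / c) *\<^sub>R S = Aadj A (y' - y)"
      using y' dual_eq unfolding S'r linear_diff[OF linear_Aadj] scaleR_left_diff_distrib scaleR_one
      by (metis (no_types, lifting) add_diff_cancel_left' add_diff_cancel_right' diff_diff_eq2 diff_eq_eq add.commute)
    then have "S = Aadj A ((1 / (1 - r / c)) *\<^sub>R (y' - y))"
      using rc unfolding linear_cmul[OF linear_Aadj]
      by (metis nonzero_eq_divide_eq scaleR_one scaleR_scaleR)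
    then have "C = Aadj A (y + (1 / (1 - r / c)) *\<^sub>R (y' - y))"
      using dual_eq by (simp only: linear_add[OF linear_Aadj])
    then show False using C_notin by blast
  qed
  then have "S' = S" using S'r c by simp
  moreover have "Aadj A (y' - y) = 0"
    using y' dual_eq calculation unfolding linear_diff[OF linear_Aadj] by (metis add_right_cancel diff_self)
  ultimately show ?thesis using A_indep by force
qed

lemma XE_eq: "XE C A b E \<alpha> = X"
  unfolding XE_def using opt primal_unique by (rule the_equality)

lemma ySE_eq: "ySE C A b E \<alpha> = (y, S)"
  unfolding ySE_def
proof (rule the_equality)
  have feas: "QPdual_feas C A E \<alpha> y S"
    using dual_eq S_dual by (simp add: QPdual_feas_def)
  then show "QPdual_opt C A b E \<alpha> (fst (y, S)) (snd (y, S))"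
    using weak_duality by (simp add: QPdual_opt_def)
  fix yS assume "QPdual_opt C A b E \<alpha> (fst yS) (snd yS)"
  then have "QPdual_feas C A E \<alpha> (fst yS) (snd yS)" "b \<bullet> y \<le> b \<bullet> fst yS"
    using feas by (auto simp: QPdual_opt_def)
  then show "yS = (y, S)"
    using dual_unique weak_duality by (metis antisym prod.collapse)
qed

lemma yE_eq: "yE C A b E \<alpha> = y" and SE_eq: "SE C A b E \<alpha> = S"
  by (simp_all add: yE_def SE_def ySE_eq)

lemma normE_X: "normE E X = k * \<alpha>"
proof -
  have "X = R ** (k *\<^sub>R Q) ** transpose R" by (simp add: matrix_scalar_ac scalar_matrix_assoc[symmetric])
  then show ?thesis
    using normE_factor[OF RT TR, of "k *\<^sub>R Q"] k by (simp add: symm_scaleR symQ norm_Q[OF Q])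
qed

section \<open>The quadratic in the step length and its minimiser\<close>

lemma move_eq: "E + t *\<^sub>R X = R ** (mat 1 + (t * k) *\<^sub>R Q) ** transpose R"
  by (simp add: matrix_ring_simps)

text \<open>The factors \<open>transpose R ** transpose T\<close> cancel, so the product is similar
  to \<open>c\<close> times a matrix in \<open>Q\<close> alone, and similarity preserves the traces
  that determine the step.\<close>

lemma move_S:
  "(E + t *\<^sub>R X) ** S = c *\<^sub>R (R ** ((mat 1 + (t * k) *\<^sub>R Q) ** (mat 1 - Q)) ** T)"
proof -
  have "(E + t *\<^sub>R X) ** S
      = c *\<^sub>R (R ** (mat 1 + (t * k) *\<^sub>R Q) ** (transpose R ** transpose T) ** (mat 1 - Q) ** T)"
    by (simp only: move_eq matrix_scalar_ac matrix_mul_assoc scalar_matrix_assoc[symmetric])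
  then show ?thesis
    by (simp only: transpose_inverse_factor[OF RT TR] matrix_mul_rid matrix_mul_assoc)
qed

lemma trace_similar: "trace (R ** M ** T) = trace M"
  by (metis TR matrix_mul_assoc matrix_mul_rid trace_mul_sym)

lemma trace_move_S: "trace ((E + t *\<^sub>R X) ** S) = c * (real CARD('n) - \<alpha>\<^sup>2)"
  unfolding move_S trace_scaleR trace_similar trace_shift[OF Q] ..

lemma trace_move_S_square:
  "trace ((E + t *\<^sub>R X) ** S ** ((E + t *\<^sub>R X) ** S))
    = c\<^sup>2 * (real CARD('n) - \<alpha>\<^sup>2 - 2 * (t * k) * slope Q + (t * k)\<^sup>2 * curv Q)"
proof -
  let ?N = "(mat 1 + (t * k) *\<^sub>R Q) ** (mat 1 - Q)"
  have "(R ** ?N ** T) ** (R ** ?N ** T) = R ** ?N ** (T ** R) ** ?N ** T"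
    by (simp only: matrix_mul_assoc)
  also have "\<dots> = R ** (?N ** ?N) ** T"
    by (simp only: TR matrix_mul_rid matrix_mul_assoc)
  finally have "trace ((R ** ?N ** T) ** (R ** ?N ** T)) = ?N \<bullet> ?N"
    by (simp only: trace_similar trace_mult_symm[OF symm_shift[OF Q]])
  then show ?thesis
    unfolding move_S inner_shift[OF Q]
    by (simp only: matrix_scalar_ac scalar_matrix_assoc[symmetric] trace_scaleR power2_eq_square mult.assoc)
qed

lemma tE_eq: "tE C A b E \<alpha> = slope Q / curv Q / k"
proof -
  have min: "(\<forall>s. trace ((E + t *\<^sub>R X) ** S ** ((E + t *\<^sub>R X) ** S))
          \<le> trace ((E + s *\<^sub>R X) ** S ** ((E + s *\<^sub>R X) ** S)))
       \<longleftrightarrow> t = slope Q / curv Q / k" for t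
  proof -
    have "(\<forall>s. trace ((E + t *\<^sub>R X) ** S ** ((E + t *\<^sub>R X) ** S))
          \<le> trace ((E + s *\<^sub>R X) ** S ** ((E + s *\<^sub>R X) ** S)))
      \<longleftrightarrow> (\<forall>s. (real CARD('n) - \<alpha>\<^sup>2) - 2 * (t * k) * slope Q + (t * k)\<^sup>2 * curv Q
          \<le> (real CARD('n) - \<alpha>\<^sup>2) - 2 * (s * k) * slope Q + (s * k)\<^sup>2 * curv Q)"
      unfolding trace_move_S_square using c by (simp add: mult_le_cancel_left_pos)
    \<comment> \<open>Evaluating at \<open>s / k\<close> absorbs the scale, so the quadratic is in
      the variable \<open>t * k\<close>.\<close>
    also have "\<dots> \<longleftrightarrow> (\<forall>s. (real CARD('n) - \<alpha>\<^sup>2) - 2 * (t * k) * slope Q + (t * k)\<^sup>2 * curv Q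
          \<le> (real CARD('n) - \<alpha>\<^sup>2) - 2 * s * slope Q + s\<^sup>2 * curv Q)"
    proof (intro iffI allI)
      fix s
      assume "\<forall>s. (real CARD('n) - \<alpha>\<^sup>2) - 2 * (t * k) * slope Q + (t * k)\<^sup>2 * curv Q
          \<le> (real CARD('n) - \<alpha>\<^sup>2) - 2 * (s * k) * slope Q + (s * k)\<^sup>2 * curv Q"
      from this[rule_format, of "s / k"] show "(real CARD('n) - \<alpha>\<^sup>2) - 2 * (t * k) * slope Q + (t * k)\<^sup>2 * curv Q
          \<le> (real CARD('n) - \<alpha>\<^sup>2) - 2 * s * slope Q + s\<^sup>2 * curv Q" using k by simp
    qed auto
    also have "\<dots> \<longleftrightarrow> t * k = slope Q / curv Q"
      by (rule quadratic_minimiser_iff[OF curv_pos[OF Q]])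
    also have "\<dots> \<longleftrightarrow> t = slope Q / curv Q / k"
      using k nonzero_eq_divide_eq[of k t "slope Q / curv Q"] by blast
    finally show ?thesis .
  qed
  show ?thesis
    unfolding tE_def XE_eq SE_eq Let_def min by simp
qed

lemma step_ge_half: "1 / 2 \<le> slope Q / curv Q"
proof -
  have "curv Q \<le> (1 + \<alpha>) * slope Q" by (rule curv_le[OF Q])
  also have "\<dots> \<le> 2 * slope Q"
    using alpha slope_pos[OF Q] by (intro mult_right_mono) auto
  finally show ?thesis using curv_pos[OF Q] by (simp add: pos_le_divide_eq)
qed

lemma tE_pos: "0 < tE C A b E \<alpha>"
  unfolding tE_eq using k slope_pos[OF Q] curv_pos[OF Q] by simp

text \<open>The factor \<open>k\<close> cancels between the norm of \<open>X\<close> and the step,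
  leaving \<open>step_ge_half\<close>. A small optimal solution thus forces a long step.\<close>

lemma tE_ge: "\<alpha> \<le> 2 * tE C A b E \<alpha> * normE E (XE C A b E \<alpha>)"
proof -
  have "2 * tE C A b E \<alpha> * normE E (XE C A b E \<alpha>) = 2 * (slope Q / curv Q) * \<alpha>"
    unfolding XE_eq normE_X tE_eq using k by simp
  moreover have "1 * \<alpha> \<le> 2 * (slope Q / curv Q) * \<alpha>"
    using step_ge_half alpha by (intro mult_right_mono) linarith+
  ultimately show ?thesis by simp
qed

section \<open>The next iterate and its dual margin\<close>

abbreviation "t \<equiv> tE C A b E \<alpha>"
abbreviation "E' \<equiv> nextE C A b \<alpha> E"

lemma nextE_eq: "E' = (1 / (1 + t)) *\<^sub>R (E + t *\<^sub>R X)"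
  by (simp only: nextE_def XE_eq)

lemma tk: "t * k = slope Q / curv Q"
  using k by (simp add: tE_eq)

text \<open>The step ends at the minimiser of the quadratic, the last point covered by
  \<open>posdef_shift\<close>.\<close>

lemma posdef_nextE: "posdef E'"
proof -
  have "posdef (mat 1 + (t * k) *\<^sub>R Q)"
    using slope_pos[OF Q] curv_pos[OF Q] by (intro posdef_shift[OF Q]) (auto simp: tk)
  then show ?thesis
    unfolding nextE_eq move_eq using tE_pos by (intro posdef_scaleR posdef_congruence[OF RT]) auto
qed

lemma feas_nextE: "Aop A E' = b"
proof -
  have "Aop A (E + t *\<^sub>R X) = (1 + t) *\<^sub>R b"
    unfolding linear_add[OF linear_Aop, of E] linear_cmul[OF linear_Aop, of t X] feasE feasX
    by (simp only: scaleR_left_distrib scaleR_one)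
  then show ?thesis
    unfolding nextE_eq linear_cmul[OF linear_Aop, of "1 / (1 + t)"] using tE_pos by simp
qed

lemma trace_nextE_S: "trace (E' ** S) = c / (1 + t) * (real CARD('n) - \<alpha>\<^sup>2)"
  by (simp only: nextE_eq scalar_matrix_assoc[symmetric] trace_scaleR trace_move_S) simp

text \<open>At its minimiser the quadratic has dropped by \<open>(slope Q)\<^sup>2 / curv Q\<close>,
  the deficit \<open>d\<close> for \<open>dual_cone_interior\<close>.\<close>

lemma trace_nextE_S_square:
  "trace (E' ** S ** (E' ** S)) = (c / (1 + t))\<^sup>2 * (real CARD('n) - \<alpha>\<^sup>2 - (slope Q)\<^sup>2 / curv Q)"
proof -
  have "trace (E' ** S ** (E' ** S)) = (1 / (1 + t))\<^sup>2 * trace ((E + t *\<^sub>R X) ** S ** ((E + t *\<^sub>R X) ** S))"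
    by (simp only: nextE_eq scalar_matrix_assoc[symmetric] matrix_scalar_ac trace_scaleR power2_eq_square
        mult.assoc mult.left_commute)
  also have "\<dots> = (1 / (1 + t))\<^sup>2 * (c\<^sup>2 * (real CARD('n) - \<alpha>\<^sup>2 - (slope Q)\<^sup>2 / curv Q))"
    unfolding trace_move_S_square tk using curv_pos[OF Q] by (simp add: power2_eq_square)
  finally show ?thesis by (simp add: power_divide)
qed

text \<open>In coordinates of \<open>E'\<close> the slack \<open>S\<close> becomes \<open>N\<close>,
  whose trace and squared norm are the traces of \<open>E' ** S\<close> and of its square;
  \<open>dual_cone_interior\<close> then applies.\<close>

lemma nextE_interior:
  assumes "Z \<in> KE E' \<alpha>"
  shows "normE E' Z * (trace (E' ** S) * (\<alpha> * (1 - \<alpha>) / 4) / real CARD('n)) \<le> trace (Z ** S)"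
proof -
  obtain U V :: "real^'n^'n" where UV: "U ** V = mat 1" "V ** U = mat 1" and EU: "E' = U ** transpose U"
    using posdef_factor[OF posdef_nextE] by blast
  define M where "M = V ** Z ** transpose V"
  have ZM: "Z = U ** M ** transpose U"
    by (simp add: M_def congruence_inverse[OF UV])
  have symM: "symm M" and M: "\<alpha> * norm M \<le> trace M"
    using assms by (auto simp: EU ZM KE_factor[OF UV])
  define N where "N = transpose U ** S ** U"
  have symN: "symm N"
    using symm_congruence[OF symm_S, of "transpose U"] by (simp add: N_def)
  have trN: "trace N = trace (E' ** S)"
    by (simp only: N_def EU) (metis matrix_mul_assoc trace_mul_sym)
  have "N \<bullet> N = trace (transpose U ** (S ** U ** (transpose U ** S ** U)))"
    using trace_mult_symm[OF symN, of N] by (simp only: N_def matrix_mul_assoc)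
  also have "\<dots> = trace (S ** U ** (transpose U ** S ** U) ** transpose U)"
    by (rule trace_mul_sym)
  also have "\<dots> = trace (S ** (E' ** S ** E'))"
    by (simp only: EU matrix_mul_assoc)
  also have "\<dots> = trace (E' ** S ** E' ** S)"
    by (rule trace_mul_sym)
  finally have NN: "N \<bullet> N = trace (E' ** S ** (E' ** S))"
    by (simp only: matrix_mul_assoc)
  \<comment> \<open>The source of the margin \<open>\<alpha> * (1 - \<alpha>) / 4\<close>:
    \<open>slope_ge\<close> times \<open>step_ge_half\<close>.\<close>
  have d: "2 * \<alpha> * (\<alpha> * (1 - \<alpha>) / 4) \<le> (slope Q)\<^sup>2 / curv Q"
  proof -
    have "2 * \<alpha> * (\<alpha> * (1 - \<alpha>) / 4) = \<alpha>\<^sup>2 * (1 - \<alpha>) * (1 / 2)"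
      by (simp add: power2_eq_square)
    also have "\<dots> \<le> slope Q * (slope Q / curv Q)"
      using slope_ge[OF Q] step_ge_half slope_pos[OF Q] by (intro mult_mono) auto
    finally show ?thesis by (simp add: power2_eq_square)
  qed
  have "norm M * (trace N * (\<alpha> * (1 - \<alpha>) / 4) / real CARD('n)) \<le> M \<bullet> N"
  proof (rule dual_cone_interior[OF alpha M])
    show "0 < c / (1 + t)" using c tE_pos by simp
    show "trace N = c / (1 + t) * (real CARD('n) - \<alpha>\<^sup>2)" by (simp only: trN trace_nextE_S)
    show "N \<bullet> N \<le> (c / (1 + t))\<^sup>2 * (real CARD('n) - \<alpha>\<^sup>2 - (slope Q)\<^sup>2 / curv Q)"
      by (simp only: NN trace_nextE_S_square)
    show "0 \<le> \<alpha> * (1 - \<alpha>) / 4" using alpha by simp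
    show "\<alpha> * (1 - \<alpha>) / 4 \<le> \<alpha>" using alpha by simp
  qed (rule d)
  moreover have "trace (Z ** S) = M \<bullet> N"
    by (simp only: ZM trace_congruence N_def[symmetric] trace_mult_symm[OF symM])
  moreover have "normE E' Z = norm M"
    by (simp only: EU ZM normE_factor[OF UV symM])
  ultimately show ?thesis by (simp only: trN)
qed

text \<open>The old pair \<open>y\<close>, \<open>S\<close> still satisfies the dual equation and
  now has a positive margin at \<open>E'\<close>, as \<open>optimal_exists\<close> asks.\<close>

lemma nextE_Swath: "E' \<in> Swath C A b \<alpha>"
proof (rule optimal_exists[OF posdef_nextE feas_nextE dual_eq])
  have "0 < trace (E' ** S)"
    unfolding trace_nextE_S using c tE_pos card_minus_alpha_pos by simp
  then show "0 < trace (E' ** S) * (\<alpha> * (1 - \<alpha>) / 4) / real CARD('n)"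
    using alpha by simp
qed (use nextE_interior in \<open>simp only: mult.commute\<close>)

lemma gapE_eq: "gapE C A b E \<alpha> = c * (real CARD('n) - \<alpha>\<^sup>2)"
proof -
  have "trace (E ** S) = c * (real CARD('n) - \<alpha>\<^sup>2)"
    using trace_move_S[of 0] by simp
  then show ?thesis
    using objective_eq[OF dual_eq feasE] by (simp only: gapE_def yE_eq)
qed

end

subsection \<open>Progress of the iteration\<close>

context sdp
begin

lemma Swath_step:
  assumes "E \<in> Swath C A b \<alpha>"
  shows "nextE C A b \<alpha> E \<in> Swath C A b \<alpha>"
    and "QP_opt C A b E \<alpha> (XE C A b E \<alpha>)"
    and "Aadj A (yE C A b E \<alpha>) + SE C A b E \<alpha> = C"
    and "trace (C ** XE C A b E \<alpha>) = b \<bullet> yE C A b E \<alpha>"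
    and "0 < gapE C A b E \<alpha>"
    and "0 < tE C A b E \<alpha>"
    and "\<alpha> \<le> 2 * tE C A b E \<alpha> * normE E (XE C A b E \<alpha>)"
    and "trace (nextE C A b \<alpha> E ** SE C A b E \<alpha>) = gapE C A b E \<alpha> / (1 + tE C A b E \<alpha>)"
    and "Z \<in> KE (nextE C A b \<alpha> E) \<alpha> \<Longrightarrow>
      normE (nextE C A b \<alpha> E) Z
        * (trace (nextE C A b \<alpha> E ** SE C A b E \<alpha>) * (\<alpha> * (1 - \<alpha>) / 4) / real CARD('n))
        \<le> trace (Z ** SE C A b E \<alpha>)"
proof -
  obtain X where pd: "posdef E" and feas: "Aop A E = b" and X: "QP_opt C A b E \<alpha> X"
    using assms by (auto simp: Swath_def)
  obtain R T :: "real^'n^'n" where RT: "R ** T = mat 1" and TR: "T ** R = mat 1"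
    and ER: "E = R ** transpose R"
    using posdef_factor[OF pd] by blast
  obtain k c Q y where *: "k > 0" "c > 0" "symm Q" "trace Q = \<alpha>\<^sup>2" "Q \<bullet> Q = \<alpha>\<^sup>2"
    "X = k *\<^sub>R (R ** Q ** transpose R)"
    "Aadj A y + c *\<^sub>R (transpose T ** (mat 1 - Q) ** T) = C"
    using optimal_structure[OF RT TR feas[unfolded ER] X[unfolded ER]] by blast
  interpret o: sdp_optimal C A b \<alpha> R T Q k c y
    by unfold_locales (use RT TR feas X ER * in auto)
  note eqs = ER o.XE_eq o.yE_eq o.SE_eq
  show "nextE C A b \<alpha> E \<in> Swath C A b \<alpha>" "QP_opt C A b E \<alpha> (XE C A b E \<alpha>)"
    "Aadj A (yE C A b E \<alpha>) + SE C A b E \<alpha> = C"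
    unfolding eqs by (fact o.nextE_Swath o.opt o.dual_eq)+
  show "trace (C ** XE C A b E \<alpha>) = b \<bullet> yE C A b E \<alpha>"
    unfolding eqs using objective_eq[OF o.dual_eq o.feasX] o.trace_XS by simp
  show "0 < gapE C A b E \<alpha>"
    unfolding ER o.gapE_eq using * card_minus_alpha_pos by simp
  show "0 < tE C A b E \<alpha>" "\<alpha> \<le> 2 * tE C A b E \<alpha> * normE E (XE C A b E \<alpha>)"
    unfolding ER by (fact o.tE_pos o.tE_ge)+
  show "trace (nextE C A b \<alpha> E ** SE C A b E \<alpha>) = gapE C A b E \<alpha> / (1 + tE C A b E \<alpha>)"
    unfolding eqs o.trace_nextE_S o.gapE_eq by simp
  show "normE (nextE C A b \<alpha> E) Z
        * (trace (nextE C A b \<alpha> E ** SE C A b E \<alpha>) * (\<alpha> * (1 - \<alpha>) / 4) / real CARD('n))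
        \<le> trace (Z ** SE C A b E \<alpha>)" if "Z \<in> KE (nextE C A b \<alpha> E) \<alpha>"
    using that unfolding eqs by (rule o.nextE_interior)
qed

text \<open>The new value is a weighted mean of the values at \<open>E\<close> and at its optimal
  solution, and these differ by the positive gap.\<close>

lemma primal_decrease:
  assumes "E \<in> Swath C A b \<alpha>"
  shows "trace (C ** nextE C A b \<alpha> E) < trace (C ** E)"
proof -
  note st = Swath_step[OF assms]
  let ?t = "tE C A b E \<alpha>"
  have lt: "trace (C ** XE C A b E \<alpha>) < trace (C ** E)"
    using st(4,5) by (simp add: gapE_def)
  have "trace (C ** nextE C A b \<alpha> E) * (1 + ?t) = trace (C ** E) + ?t * trace (C ** XE C A b E \<alpha>)"
    using st(6) by (simp add: nextE_def matrix_ring_simps flip: add_divide_distrib)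
  also have "\<dots> < trace (C ** E) * (1 + ?t)"
    using mult_strict_left_mono[OF lt st(6)] by (simp add: distrib_left mult.commute)
  finally show ?thesis using st(6) by simp
qed

text \<open>\<open>objective_eq\<close> with the old dual pair, taken at the new optimal solution
  for the first equation and also at \<open>E'\<close> for the second.\<close>

lemma gap_next_eq:
  assumes "E \<in> Swath C A b \<alpha>"
  defines "E' \<equiv> nextE C A b \<alpha> E"
  shows "b \<bullet> yE C A b E' \<alpha> = b \<bullet> yE C A b E \<alpha> + trace (XE C A b E' \<alpha> ** SE C A b E \<alpha>)"
    and "gapE C A b E' \<alpha> = gapE C A b E \<alpha> / (1 + tE C A b E \<alpha>) - trace (XE C A b E' \<alpha> ** SE C A b E \<alpha>)"
proof -
  note st = Swath_step[OF assms(1)]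
  have E': "E' \<in> Swath C A b \<alpha>" using st(1) by (simp add: E'_def)
  have feas: "Aop A E' = b" using E' by (simp add: Swath_def)
  have feas': "Aop A (XE C A b E' \<alpha>) = b"
    using Swath_step(2)[OF E'] by (simp add: QP_opt_def QP_feas_def)
  show 1: "b \<bullet> yE C A b E' \<alpha> = b \<bullet> yE C A b E \<alpha> + trace (XE C A b E' \<alpha> ** SE C A b E \<alpha>)"
    using objective_eq[OF st(3) feas'] Swath_step(4)[OF E'] by simp
  show "gapE C A b E' \<alpha> = gapE C A b E \<alpha> / (1 + tE C A b E \<alpha>) - trace (XE C A b E' \<alpha> ** SE C A b E \<alpha>)"
    using objective_eq[OF st(3) feas] st(8) 1 by (simp add: gapE_def E'_def[symmetric])
qed

lemma dual_gain:
  assumes "E \<in> Swath C A b \<alpha>"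
  defines "E' \<equiv> nextE C A b \<alpha> E"
  shows "normE E' (XE C A b E' \<alpha>)
      * (gapE C A b E \<alpha> / (1 + tE C A b E \<alpha>) * (\<alpha> * (1 - \<alpha>) / 4) / real CARD('n))
      \<le> trace (XE C A b E' \<alpha> ** SE C A b E \<alpha>)"
proof -
  note st = Swath_step[OF assms(1)]
  have "XE C A b E' \<alpha> \<in> KE E' \<alpha>"
    using Swath_step(2)[OF st(1)] by (simp add: QP_opt_def QP_feas_def E'_def)
  then show ?thesis
    using st(9) unfolding E'_def st(8) by blast
qed

lemma normE_XE_pos:
  assumes "E \<in> Swath C A b \<alpha>"
  shows "0 < normE E (XE C A b E \<alpha>)"
proof (rule ccontr)
  assume "\<not> 0 < normE E (XE C A b E \<alpha>)"
  then have "2 * tE C A b E \<alpha> * normE E (XE C A b E \<alpha>) \<le> 0"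
    using Swath_step(6)[OF assms] by (simp add: mult_le_0_iff)
  then show False using Swath_step(7)[OF assms] alpha by simp
qed

text \<open>The increase is the trace term of \<open>gap_next_eq\<close>, which
  \<open>dual_gain\<close> bounds below by a nonnegative number.\<close>

lemma dual_increase:
  assumes "E \<in> Swath C A b \<alpha>"
  shows "b \<bullet> yE C A b E \<alpha> \<le> b \<bullet> yE C A b (nextE C A b \<alpha> E) \<alpha>"
proof -
  note st = Swath_step[OF assms]
  have "0 \<le> gapE C A b E \<alpha> / (1 + tE C A b E \<alpha>) * (\<alpha> * (1 - \<alpha>) / 4) / real CARD('n)"
    using st(5,6) alpha by simp
  then have "0 \<le> trace (XE C A b (nextE C A b \<alpha> E) \<alpha> ** SE C A b E \<alpha>)"
    using dual_gain[OF assms] normE_XE_pos[OF st(1)] by (meson mult_nonneg_nonneg less_imp_le order_trans)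
  then show ?thesis using gap_next_eq(1)[OF assms] by simp
qed

text \<open>If the optimal solution at \<open>E'\<close> has norm at least \<open>sqrt (2 n / (1 - \<alpha>))\<close>, then the dual
  objective gains enough in the step from \<open>E\<close> to \<open>E'\<close>; otherwise the next step length is at least
  \<open>\<kappa> / sqrt n\<close>.\<close>

lemma gap_reduction:
  assumes E: "E \<in> Swath C A b \<alpha>"
  defines "E' \<equiv> nextE C A b \<alpha> E" and "E'' \<equiv> nextE C A b \<alpha> (nextE C A b \<alpha> E)"
  defines "\<kappa> \<equiv> \<alpha> * sqrt ((1 - \<alpha>) / 8)" and "\<rho> \<equiv> sqrt (real CARD('n))"
  shows "gapE C A b E' \<alpha> / gapE C A b E \<alpha> \<le> 1 - \<kappa> / (\<kappa> + \<rho>) \<or>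
    gapE C A b E'' \<alpha> / gapE C A b E' \<alpha> \<le> 1 - \<kappa> / (\<kappa> + \<rho>)"
proof -
  note st = Swath_step[OF E]
  have E': "E' \<in> Swath C A b \<alpha>" using st(1) by (simp add: E'_def)
  note st' = Swath_step[OF E']
  \<comment> \<open>The norm threshold divided by \<open>\<rho>\<close>. It is balanced so that
    \<open>kmu\<close> and \<open>mk\<close> hold with the same \<open>\<kappa>\<close>, one for
    each case.\<close>
  define \<mu> where "\<mu> = sqrt (2 / (1 - \<alpha>))"
  define N where "N = normE E' (XE C A b E' \<alpha>)"
  have rho: "\<rho> > 0" "\<rho> * \<rho> = real CARD('n)" by (simp_all add: \<rho>_def)
  have mu: "\<mu> > 0" using alpha by (simp add: \<mu>_def)
  have kap: "\<kappa> > 0" using alpha by (simp add: \<kappa>_def)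
  have "sqrt ((1 - \<alpha>) / 8) * \<mu> = sqrt ((1 / 2)\<^sup>2)"
    using alpha by (simp add: \<mu>_def power2_eq_square flip: real_sqrt_mult)
  then have half: "sqrt ((1 - \<alpha>) / 8) * \<mu> = 1 / 2" by (simp only: real_sqrt_abs)
  have "2 * \<kappa> * \<mu> = \<alpha> * (2 * (sqrt ((1 - \<alpha>) / 8) * \<mu>))" by (simp only: \<kappa>_def mult_ac)
  then have kmu: "2 * \<kappa> * \<mu> = \<alpha>" by (simp add: half)
  have mu2: "\<mu> * \<mu> * (1 - \<alpha>) = 2"
    using alpha nonzero_eq_divide_eq[of "1 - \<alpha>" "\<mu> * \<mu>" 2] by (simp add: \<mu>_def)
  have "\<mu> * (\<alpha> * (1 - \<alpha>) / 4) * (\<mu> * 2) = \<alpha> * (\<mu> * \<mu> * (1 - \<alpha>)) / 2" by simp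
  also have "\<dots> = \<kappa> * (\<mu> * 2)" unfolding mu2 using kmu by simp
  finally have "\<mu> * (\<alpha> * (1 - \<alpha>) / 4) * (\<mu> * 2) = \<kappa> * (\<mu> * 2)" .
  then have mk: "\<mu> * (\<alpha> * (1 - \<alpha>) / 4) = \<kappa>"
    using mu mult_right_cancel[of "\<mu> * 2"] by fastforce
  have target: "1 - \<kappa> / (\<kappa> + \<rho>) = \<rho> / (\<kappa> + \<rho>)"
    using kap rho by (simp add: field_simps)
  show ?thesis
  proof (cases "\<rho> * \<mu> \<le> N")
    case True
    \<comment> \<open>The part of the gap left by the primal move alone. A large solution then
      removes at least the fraction \<open>\<kappa> / \<rho>\<close> of it, more than the claim
      needs.\<close>
    define G where "G = gapE C A b E \<alpha> / (1 + tE C A b E \<alpha>)"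
    have G: "0 < G" "G \<le> gapE C A b E \<alpha>"
      using st(5,6) by (auto simp: G_def field_simps)
    have "\<rho> * \<mu> * (G * (\<alpha> * (1 - \<alpha>) / 4) / real CARD('n)) \<le> N * (G * (\<alpha> * (1 - \<alpha>) / 4) / real CARD('n))"
      using True G alpha by (intro mult_right_mono) auto
    also have "\<dots> \<le> trace (XE C A b E' \<alpha> ** SE C A b E \<alpha>)"
      using dual_gain[OF E] by (simp only: N_def E'_def G_def)
    also have "\<rho> * \<mu> * (G * (\<alpha> * (1 - \<alpha>) / 4) / real CARD('n)) = G * (\<kappa> / \<rho>)"
      unfolding mk[symmetric] rho(2)[symmetric] using rho(1) by simp
    finally have "gapE C A b E' \<alpha> \<le> G * (1 - \<kappa> / \<rho>)"
      using gap_next_eq(2)[OF E] by (simp add: E'_def G_def right_diff_distrib)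
    also have "\<dots> \<le> G * (1 - \<kappa> / (\<kappa> + \<rho>))"
      using G kap rho by (intro mult_left_mono diff_left_mono divide_left_mono) auto
    also have "\<dots> \<le> gapE C A b E \<alpha> * (1 - \<kappa> / (\<kappa> + \<rho>))"
      using G kap rho unfolding target by (intro mult_right_mono) auto
    finally show ?thesis using st(5) by (simp add: pos_divide_le_eq mult.commute)
  next
    case False
    let ?t = "tE C A b E' \<alpha>"
    \<comment> \<open>A small solution gives \<open>?t * \<rho> \<ge> \<kappa>\<close>; the primal
      move alone then suffices, the dual gain being only nonnegative.\<close>
    have "2 * \<kappa> * \<mu> \<le> 2 * ?t * N" using st'(7) by (simp add: kmu N_def)
    also have "\<dots> \<le> 2 * ?t * (\<rho> * \<mu>)"
      using False st'(6) by (intro mult_left_mono) auto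
    finally have "\<kappa> * \<mu> \<le> (?t * \<rho>) * \<mu>" by simp
    then have tr: "\<kappa> \<le> ?t * \<rho>" using mu by simp
    have gain: "0 \<le> trace (XE C A b E'' \<alpha> ** SE C A b E' \<alpha>)"
      using dual_increase[OF E'] gap_next_eq(1)[OF E'] by (simp add: E'_def E''_def)
    have "gapE C A b E'' \<alpha> \<le> gapE C A b E' \<alpha> / (1 + ?t)"
      using gap_next_eq(2)[OF E'] gain by (simp add: E'_def E''_def)
    then have "gapE C A b E'' \<alpha> / gapE C A b E' \<alpha> \<le> 1 / (1 + ?t)"
      using st'(5) by (simp add: pos_divide_le_eq)
    also have "\<dots> \<le> \<rho> / (\<kappa> + \<rho>)"
      using tr kap rho st'(6) by (simp add: divide_simps distrib_left mult.commute)
    finally show ?thesis by (simp add: target)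
  qed
qed

lemma funpow_nextE_Swath:
  "E \<in> Swath C A b \<alpha> \<Longrightarrow> (nextE C A b \<alpha> ^^ i) E \<in> Swath C A b \<alpha>"
  by (induction i) (simp_all add: Swath_step(1))

end

theorem mainTheorem1:
  fixes C :: "real^'n^'n" and A :: "'m::finite \<Rightarrow> real^'n^'n" and b :: "real^'m"
    and \<alpha> :: real and E :: "real^'n^'n"
  assumes symC: "symm C" and symA: "\<forall>i. symm (A i)"
    and primal_strict: "\<exists>X. posdef X \<and> Aop A X = b"
    and dual_strict: "\<exists>y S. posdef S \<and> Aadj A y + S = C"
    and b_nz: "b \<noteq> 0"
    and C_notin: "\<not> (\<exists>y. C = Aadj A y)"
    and A_indep: "\<forall>y. Aadj A y = 0 \<longrightarrow> y = 0"
    and alpha: "0 < \<alpha>" "\<alpha> < 1"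
    and E: "E \<in> Swath C A b \<alpha>"
  shows "nextE C A b \<alpha> E \<in> Swath C A b \<alpha>
    \<and> trace (C ** E) > trace (C ** nextE C A b \<alpha> E)
    \<and> b \<bullet> yE C A b E \<alpha> \<le> b \<bullet> yE C A b (nextE C A b \<alpha> E) \<alpha>
    \<and> (\<forall>E0 \<in> Swath C A b \<alpha>. \<forall>i::nat.
         let Es = (\<lambda>k. (nextE C A b \<alpha> ^^ k) E0);
             \<kappa> = \<alpha> * sqrt ((1 - \<alpha>) / 8)
         in \<exists>j\<in>{i, i+1}.
              gapE C A b (Es (j+1)) \<alpha> / gapE C A b (Es j) \<alpha>
                \<le> 1 - \<kappa> / (\<kappa> + sqrt (real CARD('n))))"
proof -
  interpret sdp C A b \<alpha>
    by unfold_locales (use assms in auto)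
  show ?thesis
    unfolding Let_def
  proof (intro conjI ballI allI)
    show "nextE C A b \<alpha> E \<in> Swath C A b \<alpha>" by (rule Swath_step(1)[OF E])
    show "trace (C ** nextE C A b \<alpha> E) < trace (C ** E)" by (rule primal_decrease[OF E])
    show "b \<bullet> yE C A b E \<alpha> \<le> b \<bullet> yE C A b (nextE C A b \<alpha> E) \<alpha>" by (rule dual_increase[OF E])
    fix E0 and i :: nat assume "E0 \<in> Swath C A b \<alpha>"
    \<comment> \<open>For the iterate of index \<open>i\<close>, the two disjuncts are the cases
      \<open>j = i\<close> and \<open>j = i + 1\<close>.\<close>
    from gap_reduction[OF funpow_nextE_Swath[OF this, of i]]
    show "\<exists>j\<in>{i, i + 1}. gapE C A b ((nextE C A b \<alpha> ^^ (j + 1)) E0) \<alpha> / gapE C A b ((nextE C A b \<alpha> ^^ j) E0) \<alpha>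
        \<le> 1 - \<alpha> * sqrt ((1 - \<alpha>) / 8) / (\<alpha> * sqrt ((1 - \<alpha>) / 8) + sqrt (real CARD('n)))"
      by simp
  qed
qed

end
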